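(* Let $\alpha:\mathbb{N}\to\mathbb{R}$ be a function with $\alpha(n)\to\infty$ as $n\to\infty$, and let $p=p(n)\in[0,1]$ satisfy $p(n)\ge \frac{\log n+\alpha(n)}{n}$ for all sufficiently large $n$. Then with high probability the random graph $G(n,p)$ is connected and satisfies $pc(G(n,p))\le 2$; that is, $\Pr[G(n,p)\text{ is connected and } pc(G(n,p))\le 2]\to 1$ as $n\to\infty$.
   Context: All graphs are finite, simple and undirected; $\log$ is the natural logarithm. $G(n,p)$ is the Erdős–Rényi random graph on $n$ labeled vertices in which each of the $\binom n2$ pairs of vertices is an edge independently with probability $p$. An event holds with high probability if its probability tends to $1$ as $n\to\infty$. In an edge-colored graph (adjacent edges may receive the same color), a path is proper if no two adjacent edges of the path have the same color. For a nontrivial connected graph $G$, the proper connection number $pc(G)$ is the minimum number of colors in an edge-coloring of $G$ such that every two distinct vertices of $G$ are connected by at least one proper path. *)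

theory Defs
  imports "HOL-Probability.Probability"
begin

text \<open>
  A finite simple graph is given by a finite vertex set \<open>V\<close> and a set \<open>E\<close> of two-element
  subsets of \<open>V\<close>.
\<close>

definition vertex_pairs :: "'a set \<Rightarrow> 'a set set" where
  "vertex_pairs V = {e. e \<subseteq> V \<and> card e = 2}"

fun path_edges :: "'a list \<Rightarrow> 'a set list" where
  "path_edges (u # v # vs) = {u, v} # path_edges (v # vs)"
| "path_edges _ = []"

definition is_path :: "'a set \<Rightarrow> 'a set set \<Rightarrow> 'a \<Rightarrow> 'a list \<Rightarrow> 'a \<Rightarrow> bool" where
  "is_path V E u vs v \<longleftrightarrow>
     vs \<noteq> [] \<and> hd vs = u \<and> last vs = v \<and> distinct vs \<and> set vs \<subseteq> V \<and> set (path_edges vs) \<subseteq> E"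

definition connected_graph :: "'a set \<Rightarrow> 'a set set \<Rightarrow> bool" where
  "connected_graph V E \<longleftrightarrow> V \<noteq> {} \<and> (\<forall>u\<in>V. \<forall>v\<in>V. \<exists>vs. is_path V E u vs v)"

definition proper_path :: "('a set \<Rightarrow> nat) \<Rightarrow> 'a list \<Rightarrow> bool" where
  "proper_path c vs \<longleftrightarrow> distinct_adj (map c (path_edges vs))"

text \<open>The colouring \<open>c\<close> itself is arbitrary: adjacent edges may share a colour.\<close>

definition proper_connected :: "'a set \<Rightarrow> 'a set set \<Rightarrow> ('a set \<Rightarrow> nat) \<Rightarrow> bool" where
  "proper_connected V E c \<longleftrightarrow>
     (\<forall>u\<in>V. \<forall>v\<in>V. u \<noteq> v \<longrightarrow> (\<exists>vs. is_path V E u vs v \<and> proper_path c vs))"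

text \<open>
  Only values of \<open>c\<close> on \<open>E\<close> count. The number is meaningful for connected finite graphs only;
  for a disconnected graph no colouring qualifies and \<open>LEAST\<close> is unspecified.
\<close>

definition proper_connection_number :: "'a set \<Rightarrow> 'a set set \<Rightarrow> nat" where
  "proper_connection_number V E = (LEAST k. \<exists>c. proper_connected V E c \<and> card (c ` E) = k)"

text \<open>
  The distribution of the edge set of \<open>G(n,p)\<close> on the vertex set \<open>{..<n}\<close>:
  one independent Bernoulli trial for each pair of vertices.
\<close>

definition gnp :: "nat \<Rightarrow> real \<Rightarrow> nat set set pmf" where
  "gnp n p = map_pmf (\<lambda>b. {e \<in> vertex_pairs {..<n}. b e})
     (Pi_pmf (vertex_pairs {..<n}) False (\<lambda>_. bernoulli_pmf p))"

end

theory Submission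
  imports Defs "HOL-Real_Asymp.Real_Asymp"
begin

text \<open>
  By monotonicity one may assume \<open>p \<le> 2 ln n / n\<close>. Split the vertices into residue classes modulo 4,
  orient every edge between consecutive classes cyclically, and colour it by the parity of its
  tail: then every directed path is proper. Since small sets span few edges and large sets are
  joined by an edge, this digraph is strongly connected on the vertices that have on the order of
  \<open>ln n\<close> neighbours in every class. A vertex of large total degree has two neighbours of equal
  parity in this core and joins it through an in-arc and an out-arc. The few vertices \<open>s\<close> of small
  total degree are far apart; each hangs on a neighbour \<open>h s\<close> outside the core. Of two core
  neighbours of \<open>h s\<close> of different parity, one serves for leaving and the other for entering, and
  both edges get the same colour, so that \<open>{s, h s}\<close> can take the other one. All the
  probabilistic estimates are first moment bounds.
\<close>

section \<open>Proper connection from strong orientations\<close>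

text \<open>Two residue classes would not do: every edge could then be traversed both ways, and its
  two possible tails would give it two colours. A cycle of classes needs even length for the
  parities to alternate and length above 2 for each edge to have one direction; 4 is the least such
  length. The price is that a class contains only about a quarter of the neighbours of a vertex.
  Near the connectivity threshold the bounds leave room for about \<open>n powr 0.79\<close>
  vertices that are deficient in some class, too many to keep them apart, but only for about
  \<open>n powr 0.12\<close> of small total degree. Hence the two notions \<open>bad\<close> and
  \<open>low\<close>: bad vertices may be adjacent to each other, but 0.88 + 0.21 > 1, so with high
  probability no low vertex has another bad one within distance 4. Vertices of degree 1 may occur,
  and no orientation makes them both enterable and leavable; this forces the pendant edges
  \<open>{s, h s}\<close>. The cap p \<le> 2 ln n / n keeps small sets sparse and makes each further
  vertex of a path cost only a factor n p of logarithmic size in the first moment.\<close>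

lemma path_edges_Cons: "vs \<noteq> [] \<Longrightarrow> path_edges (v # vs) = {v, hd vs} # path_edges vs"
  by (cases vs) auto

lemma path_edges_snoc: "vs \<noteq> [] \<Longrightarrow> path_edges (vs @ [v]) = path_edges vs @ [{last vs, v}]"
  by (induction vs rule: path_edges.induct) auto

lemma proper_path_Cons:
  assumes "is_path V E u vs v" "proper_path c vs" "w \<in> V" "w \<notin> set vs" "{w, u} \<in> E"
    and "path_edges vs \<noteq> [] \<Longrightarrow> c (hd (path_edges vs)) \<noteq> c {w, u}"
  shows "is_path V E w (w # vs) v" "proper_path c (w # vs)"
  using assms
  by (auto simp: is_path_def proper_path_def path_edges_Cons distinct_adj_Cons hd_map)

lemma proper_path_snoc:
  assumes "is_path V E u vs v" "proper_path c vs" "w \<in> V" "w \<notin> set vs" "{v, w} \<in> E"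
    and "path_edges vs \<noteq> [] \<Longrightarrow> c (last (path_edges vs)) \<noteq> c {v, w}"
  shows "is_path V E u (vs @ [w]) w" "proper_path c (vs @ [w])"
  using assms
  by (auto simp: is_path_def proper_path_def path_edges_snoc distinct_adj_append_iff last_map)

lemma rtrancl_imp_distinct_path:
  assumes "(a, b) \<in> A\<^sup>*" "A \<subseteq> Z \<times> Z" "a \<in> Z"
  shows "\<exists>vs. vs \<noteq> [] \<and> hd vs = a \<and> last vs = b \<and> distinct vs \<and> set vs \<subseteq> Z
           \<and> successively (\<lambda>x y. (x, y) \<in> A) vs"
  using assms(1)
proof (induction rule: rtrancl_induct)
  case base
  show ?case using assms(3) by (intro exI[of _ "[a]"]) auto
next
  case (step y z)
  then obtain vs where vs: "vs \<noteq> []" "hd vs = a" "last vs = y" "distinct vs" "set vs \<subseteq> Z"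
    "successively (\<lambda>x y. (x, y) \<in> A) vs" by blast
  show ?case
  proof (cases "z \<in> set vs")
    case True
    \<comment> \<open>A walk that returns to \<open>z\<close> is cut back to its visit there, which
      keeps the vertices distinct.\<close>
    then obtain xs ys where "vs = xs @ z # ys" by (meson split_list)
    then show ?thesis using vs
      by (intro exI[of _ "xs @ [z]"]) (auto simp: successively_append_iff hd_append split: if_splits)
  next
    case False
    then show ?thesis using vs step.hyps assms(2)
      by (intro exI[of _ "vs @ [z]"]) (auto simp: successively_append_iff)
  qed
qed

text \<open>Types alternate along arcs, so consecutive arcs have tails of different types and thus
  different colours. The last colour is expressed through the head, the vertex at which the path
  will be extended.\<close>

lemma successively_path_colours:
  assumes "successively (\<lambda>x y. (x, y) \<in> A) vs" "vs \<noteq> []"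
    and "\<And>x y. (x, y) \<in> A \<Longrightarrow> {x, y} \<in> E \<and> t x \<noteq> t y \<and> c {x, y} = (of_bool (t x) :: nat)"
  shows "set (path_edges vs) \<subseteq> E \<and> proper_path c vs \<and>
    (path_edges vs \<noteq> [] \<longrightarrow> c (hd (path_edges vs)) = of_bool (t (hd vs)) \<and>
       c (last (path_edges vs)) = of_bool (\<not> t (last vs)))"
  using assms(1,2)
proof (induction vs rule: path_edges.induct)
  case (1 u v vs)
  then show ?case
    using assms(3)[of u v] by (cases vs) (auto simp: proper_path_def)
qed (auto simp: proper_path_def)

text \<open>
  The type \<open>t\<close> of the tail is the colour of an arc. Every \<open>u \<in> h ` S\<close> reaches the core through \<open>x u\<close>
  and is reached from it through \<open>y u\<close>; since \<open>x u\<close> and \<open>y u\<close> have different types, both edges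
  can get colour 1, which leaves colour 0 for the pendant edge at \<open>u\<close>.
\<close>

lemma two_colouring_of_orientation:
  fixes V :: "'a set"
  assumes V: "V = Z \<union> h ` S \<union> S" and inj: "inj_on h S"
    and disj: "Z \<inter> S = {}" "Z \<inter> h ` S = {}" "h ` S \<inter> S = {}"
    and A: "A \<subseteq> Z \<times> Z"
    and arc: "\<And>a b. (a, b) \<in> A \<Longrightarrow> {a, b} \<in> E \<and> t a \<noteq> t b \<and> (b, a) \<notin> A"
    and strong: "\<And>a b. a \<in> Z \<Longrightarrow> b \<in> Z \<Longrightarrow> (a, b) \<in> A\<^sup>*"
    and x: "\<And>u. u \<in> h ` S \<Longrightarrow> x u \<in> Z \<and> {u, x u} \<in> E \<and> \<not> t (x u)"
    and y: "\<And>u. u \<in> h ` S \<Longrightarrow> y u \<in> Z \<and> {u, y u} \<in> E \<and> t (y u)"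
    and S: "\<And>s. s \<in> S \<Longrightarrow> {s, h s} \<in> E"
  shows "\<exists>c. range c \<subseteq> {0, 1} \<and> proper_connected V E c"
proof -
  define c :: "'a set \<Rightarrow> nat" where
    "c e = of_bool ((\<exists>(a, b)\<in>A. e = {a, b} \<and> t a) \<or> (\<exists>u\<in>h ` S. e = {u, x u} \<or> e = {u, y u}))" for e
  have c_arc: "c {a, b} = of_bool (t a)" if "(a, b) \<in> A" for a b
  proof -
    \<comment> \<open>The reversed pair is not an arc, so the edge determines its tail and its
      colour is unambiguous.\<close>
    have "(\<exists>(a', b')\<in>A. {a, b} = {a', b'} \<and> t a') \<longleftrightarrow> t a"
      using that arc[OF that] by (auto simp: doubleton_eq_iff)
    moreover have "a \<in> Z" "b \<in> Z" using that A by auto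
    then have "\<not> (\<exists>u\<in>h ` S. {a, b} = {u, x u} \<or> {a, b} = {u, y u})"
      using disj(2) by (auto simp: doubleton_eq_iff)
    ultimately show ?thesis by (simp add: c_def)
  qed
  have c_x: "c {u, x u} = 1" and c_y: "c {y u, u} = 1" if "u \<in> h ` S" for u
    using that by (auto simp: c_def insert_commute)
  have c_S: "c {s, h s} = 0" if s: "s \<in> S" for s
  proof -
    have "s \<notin> Z" using s disj by auto
    moreover have "\<not> (\<exists>u\<in>h ` S. {s, h s} = {u, x u} \<or> {s, h s} = {u, y u})"
      using s disj x y by (metis IntI doubleton_eq_iff empty_iff)
    ultimately show ?thesis using A by (auto simp: c_def doubleton_eq_iff)
  qed
  have core: "\<exists>vs. is_path V E a vs b \<and> proper_path c vs \<and> set vs \<subseteq> Z \<and>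
      (path_edges vs \<noteq> [] \<longrightarrow> c (hd (path_edges vs)) = of_bool (t a) \<and>
         c (last (path_edges vs)) = of_bool (\<not> t b))" if ab: "a \<in> Z" "b \<in> Z" for a b
  proof -
    obtain vs where vs: "vs \<noteq> []" "hd vs = a" "last vs = b" "distinct vs" "set vs \<subseteq> Z"
      "successively (\<lambda>x y. (x, y) \<in> A) vs"
      using rtrancl_imp_distinct_path[OF strong[OF ab] A ab(1)] by blast
    show ?thesis
      using successively_path_colours[of A vs E t c] vs arc c_arc V
      by (intro exI[of _ vs]) (auto simp: is_path_def)
  qed
  \<comment> \<open>\<open>R w\<close> collects the vertices outside \<open>Z\<close> that a path
    starting in \<open>w\<close> visits before it enters the core. A vertex outside both sets is
    free to be appended at the far end.\<close>
  define R where "R w = (if w \<in> S then {w, h w} else if w \<in> h ` S then {w} else {})" for w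
  have to_core: "\<exists>vs. is_path V E w vs b \<and> proper_path c vs \<and> set vs \<subseteq> Z \<union> R w \<and>
      (path_edges vs \<noteq> [] \<longrightarrow> c (last (path_edges vs)) = of_bool (\<not> t b))"
    if w: "w \<in> V" and b: "b \<in> Z" for w b
  proof -
    have from_h: "\<exists>vs. is_path V E u vs b \<and> proper_path c vs \<and> set vs \<subseteq> Z \<union> {u} \<and>
      path_edges vs \<noteq> [] \<and> c (hd (path_edges vs)) = 1 \<and> c (last (path_edges vs)) = of_bool (\<not> t b)"
      if u: "u \<in> h ` S" for u
    proof -
      obtain vs where vs: "is_path V E (x u) vs b" "proper_path c vs" "set vs \<subseteq> Z"
        "path_edges vs \<noteq> [] \<longrightarrow> c (hd (path_edges vs)) = of_bool (t (x u)) \<and>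
         c (last (path_edges vs)) = of_bool (\<not> t b)"
        using core[of "x u" b] x[OF u] b by blast
      have nin: "u \<notin> set vs" "u \<in> V" using u vs(3) disj V by auto
      have pc: "path_edges (u # vs) = {u, x u} # path_edges vs"
        using vs(1) by (auto simp: is_path_def path_edges_Cons)
      \<comment> \<open>On the trivial path the last edge is the hub edge of colour 1. This agrees
        with the formula for the last colour, because \<open>x u\<close> has type false.\<close>
      have "b = x u" if "path_edges vs = []"
        using that vs(1) by (cases vs rule: path_edges.cases) (auto simp: is_path_def)
      then show ?thesis
        using proper_path_Cons[OF vs(1,2) nin(2,1), of] x[OF u] vs(3,4) c_x[OF u]
        by (intro exI[of _ "u # vs"]) (auto simp: pc)
    qed
    consider "w \<in> Z" | "w \<in> h ` S" | "w \<in> S" using w V by auto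
    then show ?thesis
    proof cases
      case 1
      then show ?thesis using core[OF 1 b] by blast
    next
      case 2
      then have "R w = {w}" using disj by (auto simp: R_def)
      then show ?thesis using from_h[OF 2] by auto
    next
      case 3
      have "h w \<in> h ` S" using 3 by auto
      then obtain vs where vs: "is_path V E (h w) vs b" "proper_path c vs" "set vs \<subseteq> Z \<union> {h w}"
        "path_edges vs \<noteq> []" "c (hd (path_edges vs)) = 1"
        "c (last (path_edges vs)) = of_bool (\<not> t b)"
        using from_h by blast
      have "w \<noteq> h w" "w \<notin> Z" using 3 disj by auto
      then have nin: "w \<notin> set vs" using vs(3) by auto
      have "path_edges (w # vs) = {w, h w} # path_edges vs"
        using vs(1) by (auto simp: is_path_def path_edges_Cons)
      then show ?thesis
        using proper_path_Cons[OF vs(1,2) w nin S[OF 3]] vs(3-) 3 c_S[OF 3]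
        by (intro exI[of _ "w # vs"]) (auto simp: R_def)
    qed
  qed
  have to_h: "\<exists>vs. is_path V E w vs u \<and> proper_path c vs \<and> set vs \<subseteq> Z \<union> R w \<union> {u} \<and>
      path_edges vs \<noteq> [] \<and> c (last (path_edges vs)) = 1"
    if w: "w \<in> V" and u: "u \<in> h ` S" "u \<notin> R w" for w u
  proof -
    obtain vs where vs: "is_path V E w vs (y u)" "proper_path c vs" "set vs \<subseteq> Z \<union> R w"
      "path_edges vs \<noteq> [] \<longrightarrow> c (last (path_edges vs)) = of_bool (\<not> t (y u))"
      using to_core[OF w, of "y u"] y[OF u(1)] by blast
    have nin: "u \<notin> set vs" "u \<in> V" using u vs(3) disj V by auto
    have "path_edges (vs @ [u]) = path_edges vs @ [{y u, u}]"
      using vs(1) by (auto simp: is_path_def path_edges_snoc)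
    then show ?thesis
      using proper_path_snoc[OF vs(1,2) nin(2,1)] y[OF u(1)] vs(3,4) c_y[OF u(1)]
      by (intro exI[of _ "vs @ [u]"]) (auto simp: insert_commute)
  qed
  have "proper_connected V E c"
    unfolding proper_connected_def
  proof (intro ballI impI)
    fix w v assume w: "w \<in> V" and v: "v \<in> V" and wv: "w \<noteq> v"
    \<comment> \<open>In the two cases with a member of \<open>R w\<close>, a route through the core
      would revisit the hub; there \<open>w\<close> and \<open>v\<close> turn out to be the ends of
      one pendant edge.\<close>
    consider "v \<in> Z" | "v \<in> h ` S" "v \<notin> R w" | "v \<in> h ` S" "v \<in> R w"
      | "v \<in> S" "h v \<notin> R w" | "v \<in> S" "h v \<in> R w" using v V by auto
    then show "\<exists>vs. is_path V E w vs v \<and> proper_path c vs"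
    proof cases
      case 1
      then show ?thesis using to_core[OF w 1] by blast
    next
      case 2
      then show ?thesis using to_h[OF w 2] by blast
    next
      case 3
      then have "w \<in> S" "v = h w" using wv by (auto simp: R_def split: if_splits)
      then show ?thesis using S[of w] w v wv
        by (intro exI[of _ "[w, v]"]) (auto simp: is_path_def proper_path_def)
    next
      case 4
      have "h v \<in> h ` S" using 4 by auto
      then obtain vs where vs: "is_path V E w vs (h v)" "proper_path c vs"
        "set vs \<subseteq> Z \<union> R w \<union> {h v}" "c (last (path_edges vs)) = 1"
        using to_h[OF w _ 4(2)] by blast
      have "v \<notin> Z" "v \<noteq> h v" "v \<notin> h ` S" using 4(1) disj by auto
      then have "v \<notin> Z \<union> R w \<union> {h v}" using wv by (auto simp: R_def)
      then have "v \<notin> set vs" using vs(3) by blast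
      then show ?thesis
        using proper_path_snoc[OF vs(1,2) v] S[OF 4(1)] c_S[OF 4(1)] vs(4)
        by (auto simp: insert_commute)
    next
      case 5
      have "h v \<noteq> v" using 5 disj by auto
      then have "w = h v"
        using 5 wv inj disj by (auto simp: R_def inj_on_def split: if_splits)
      then show ?thesis using S[OF 5(1)] w v wv
        by (intro exI[of _ "[w, v]"]) (auto simp: is_path_def proper_path_def insert_commute)
    qed
  qed
  moreover have "range c \<subseteq> {0, 1}" by (auto simp: c_def)
  ultimately show ?thesis by blast
qed

section \<open>A deterministic criterion\<close>

lemma mod_4_pred:
  assumes "x mod 4 = (v + 3) mod (4 :: nat)" shows "v mod 4 = (x + 1) mod 4"
proof -
  have "(x + 1) mod 4 = ((v + 3) mod 4 + 1) mod 4" using assms by (metis mod_add_left_eq)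
  then show ?thesis by (simp add: mod_simps)
qed

lemma mod_4_Suc_parity:
  assumes "w mod 4 = (v + 1) mod (4 :: nat)" shows "odd v \<noteq> odd w"
proof -
  have "even (w mod 4) \<longleftrightarrow> even w" "even ((v + 1) mod 4) \<longleftrightarrow> even (v + 1)"
    by (simp_all add: dvd_mod_iff)
  then show ?thesis using assms by simp
qed

text \<open>Both congruences together give 2 d = 0 modulo 4. This is what makes the orientation of
  an edge between consecutive classes unique, read forwards for d = 1 and backwards for d =
  3.\<close>

lemma mod_4_odd_antisym:
  assumes "odd d" shows "\<not> (x mod 4 = (v + d) mod 4 \<and> v mod 4 = (x + d) mod (4 :: nat))"
proof
  assume *: "x mod 4 = (v + d) mod 4 \<and> v mod 4 = (x + d) mod 4"
  then have "(x + d) mod 4 = ((v + d) mod 4 + d) mod 4" by (metis mod_add_left_eq)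
  also have "\<dots> = (v + 2 * d) mod 4" by (simp add: mod_simps mult_2 add.assoc)
  finally have "v mod 4 = (v + 2 * d) mod 4" using * by simp
  then show False using assms by presburger
qed

definition nbrs :: "'a set set \<Rightarrow> 'a \<Rightarrow> 'a set" where
  "nbrs E v = {x. {v, x} \<in> E}"

definition res_class :: "nat \<Rightarrow> nat \<Rightarrow> nat set" where
  "res_class n j = {x. x < n \<and> x mod 4 = j}"

definition low :: "nat \<Rightarrow> nat set set \<Rightarrow> real \<Rightarrow> nat set" where
  "low n E D = {v. v < n \<and> real (card (nbrs E v)) < D}"

definition bad :: "nat \<Rightarrow> nat set set \<Rightarrow> real \<Rightarrow> nat set" where
  "bad n E D = {v. v < n \<and> (\<exists>j<4. real (card (nbrs E v \<inter> res_class n j)) < D)}"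

lemma nbrs_commute: "x \<in> nbrs E v \<longleftrightarrow> v \<in> nbrs E x"
  by (simp add: nbrs_def insert_commute)

lemma nbrs_vertex_pairs:
  assumes "E \<subseteq> vertex_pairs V" "x \<in> nbrs E v" shows "x \<in> V" "v \<in> V" "x \<noteq> v"
proof -
  have "{v, x} \<subseteq> V" "card {v, x} = 2" using assms by (auto simp: nbrs_def vertex_pairs_def)
  then show "x \<in> V" "v \<in> V" "x \<noteq> v" by auto
qed

text \<open>The typical properties of the random graph that the construction uses. Paths of 5
  vertices enter \<open>far\<close> because of the pattern s, h s, v, h s', s'. The bound 12 ensures
  D - 6 \<ge> D / 2 after up to 6 neighbours of a vertex are discarded. The range 4 * a of
  \<open>sparse\<close> meets the size \<open>a\<close> of \<open>dense\<close> by pigeonhole over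
  the four classes.\<close>

locale scattered_graph =
  fixes n :: nat and E :: "nat set set" and D :: real and a :: nat
  assumes E: "E \<subseteq> vertex_pairs {..<n}"
    and D: "D \<ge> 12"
    and nonisolated: "v < n \<Longrightarrow> nbrs E v \<noteq> {}"
    and far: "\<lbrakk>distinct vs; 2 \<le> length vs; length vs \<le> 5; set vs \<subseteq> {..<n}; set (path_edges vs) \<subseteq> E;
        hd vs \<in> low n E D; last vs \<in> bad n E D\<rbrakk> \<Longrightarrow> False"
    and few_bad: "v < n \<Longrightarrow> card (nbrs E v \<inter> bad n E D) \<le> 5"
    and dense: "\<lbrakk>A \<subseteq> {..<n}; B \<subseteq> {..<n}; A \<inter> B = {}; card A = a; card B = a\<rbrakk>
        \<Longrightarrow> \<exists>x\<in>A. \<exists>y\<in>B. {x, y} \<in> E"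
    and sparse: "\<lbrakk>U \<subseteq> {..<n}; U \<noteq> {}; card U < 4 * a\<rbrakk>
        \<Longrightarrow> real (card {e \<in> E. e \<subseteq> U}) < D / 4 * real (card U)"
begin

abbreviation "S \<equiv> low n E D"
abbreviation "Bd \<equiv> bad n E D"

lemma finite_nbrs: "finite (nbrs E v)"
  using nbrs_vertex_pairs(1)[OF E] by (meson finite_lessThan finite_subset subsetI)

lemma S_subset_Bd: "S \<subseteq> Bd"
proof
  fix v assume "v \<in> S"
  moreover have "card (nbrs E v \<inter> res_class n 0) \<le> card (nbrs E v)"
    by (intro card_mono finite_nbrs) auto
  ultimately have "v < n" "real (card (nbrs E v \<inter> res_class n 0)) < D"
    by (auto simp: low_def)
  then show "v \<in> Bd" unfolding bad_def by (auto intro!: exI[of _ 0])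
qed

lemma Bd_less: "v \<in> Bd \<Longrightarrow> v < n" by (simp add: bad_def)

section \<open>Low-degree vertices and their hubs\<close>

definition h :: "nat \<Rightarrow> nat" where "h s = (SOME x. x \<in> nbrs E s)"

lemma h_nbr: "s \<in> S \<Longrightarrow> h s \<in> nbrs E s"
  using nonisolated[of s] someI_ex[of "\<lambda>x. x \<in> nbrs E s"] by (auto simp: low_def h_def)

lemma nbr_S_not_Bd: assumes "s \<in> S" "v \<in> nbrs E s" shows "v \<notin> Bd"
proof
  assume "v \<in> Bd"
  then show False
    using far[of "[s, v]"] assms nbrs_vertex_pairs[OF E assms(2)] by (auto simp: nbrs_def)
qed

lemma no_common_nbr:
  assumes "s \<in> S" "s' \<in> S" "v \<in> nbrs E s" "v \<in> nbrs E s'" shows "s = s'"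
proof (rule ccontr)
  assume "s \<noteq> s'"
  then show False
    using far[of "[s, v, s']"] assms nbrs_vertex_pairs[OF E assms(3)]
      nbrs_vertex_pairs[OF E assms(4)] S_subset_Bd
    by (auto simp: nbrs_def insert_commute)
qed

lemma h_not_Bd: "s \<in> S \<Longrightarrow> h s \<notin> Bd"
  using nbr_S_not_Bd h_nbr by blast

lemma inj_h: "inj_on h S"
  by (intro inj_onI no_common_nbr) (use h_nbr in auto)

lemma card_nbrs_h: assumes "v \<notin> S" shows "card (nbrs E v \<inter> h ` S) \<le> 1"
proof -
  have "x = y" if x: "x \<in> nbrs E v \<inter> h ` S" and y: "y \<in> nbrs E v \<inter> h ` S" for x y
  proof (rule ccontr)
    assume xy: "x \<noteq> y"
    obtain s s' where s: "s \<in> S" "x = h s" "s' \<in> S" "y = h s'" using x y by auto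
    have e: "h s \<in> nbrs E s" "h s' \<in> nbrs E s'" using h_nbr s by auto
    have "s \<noteq> s'" using xy s by auto
    moreover have "h s \<notin> S" "h s' \<notin> S" using s h_not_Bd S_subset_Bd by auto
    ultimately have "distinct [s, x, v, y, s']"
      using s xy assms x y nbrs_vertex_pairs(3)[OF E] by auto
    then show False
      using far[of "[s, x, v, y, s']"] s x y e nbrs_vertex_pairs(1,2)[OF E] S_subset_Bd
      by (auto simp: nbrs_def insert_commute)
  qed
  then show ?thesis
    by (simp add: card_le_Suc0_iff_eq finite_nbrs)
qed

section \<open>The core digraph and its strong connectivity\<close>

definition Y :: "nat set" where "Y = {..<n} - Bd - h ` S"

text \<open>For \<open>v\<close> in the core, d = 1 gives the heads of the arcs leaving
  \<open>v\<close> and d = 3, that is -1 modulo 4, the tails of those entering it. One parameter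
  serves both directions.\<close>

definition nx :: "nat \<Rightarrow> nat \<Rightarrow> nat set" where
  "nx d v = {x \<in> nbrs E v \<inter> Y. x mod 4 = (v + d) mod 4}"

text \<open>The neighbours lost by passing to \<open>Y\<close> are at most 5 bad vertices and at
  most 1 hub.\<close>

lemma card_nbrs_Y:
  assumes "v \<notin> S" "v < n" shows "card (nbrs E v \<inter> W) \<le> card (nbrs E v \<inter> Y \<inter> W) + 6"
proof -
  have "nbrs E v \<inter> W \<subseteq> (nbrs E v \<inter> Y \<inter> W) \<union> ((nbrs E v \<inter> Bd) \<union> (nbrs E v \<inter> h ` S))"
    using nbrs_vertex_pairs(1)[OF E] by (auto simp: Y_def)
  then have "card (nbrs E v \<inter> W) \<le>
      card ((nbrs E v \<inter> Y \<inter> W) \<union> ((nbrs E v \<inter> Bd) \<union> (nbrs E v \<inter> h ` S)))"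
    by (intro card_mono) (simp_all add: finite_nbrs)
  also have "\<dots> \<le> card (nbrs E v \<inter> Y \<inter> W) + (card (nbrs E v \<inter> Bd) + card (nbrs E v \<inter> h ` S))"
    by (meson add_left_mono card_Un_le le_trans)
  finally show ?thesis using few_bad[OF assms(2)] card_nbrs_h[OF assms(1)] by linarith
qed

lemma class_nbrs_Y:
  assumes "v \<notin> Bd" "v < n" "j < 4"
  shows "real (card (nbrs E v \<inter> Y \<inter> res_class n j)) \<ge> D - 6"
proof -
  have "real (card (nbrs E v \<inter> res_class n j)) \<ge> D"
    using assms by (force simp: bad_def)
  moreover have "v \<notin> S" using assms S_subset_Bd by auto
  ultimately show ?thesis
    using card_nbrs_Y[of v "res_class n j"] assms(2) by auto
qed

lemma card_nx: assumes "v \<in> Y" shows "real (card (nx d v)) \<ge> D / 2"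
proof -
  have v: "v \<notin> Bd" "v < n" using assms by (auto simp: Y_def)
  have "nx d v = nbrs E v \<inter> Y \<inter> res_class n ((v + d) mod 4)"
    by (auto simp: nx_def res_class_def Y_def)
  then show ?thesis using class_nbrs_Y[OF v, of "(v + d) mod 4"] D by auto
qed

text \<open>Each vertex of \<open>A\<close> contributes D / 2 edges, and no edge is counted from
  both ends since its orientation is unique.\<close>

lemma arcs_le_edges:
  assumes d: "odd d" and U: "A \<subseteq> U" "\<And>v. v \<in> A \<Longrightarrow> nx d v \<subseteq> U" "U \<subseteq> {..<n}" and A: "A \<subseteq> Y"
  shows "real (card A) * (D / 2) \<le> real (card {e \<in> E. e \<subseteq> U})"
proof -
  have "A \<subseteq> {..<n}" using U(1,3) by auto
  then have fA: "finite A" using finite_subset by blast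
  have fnx: "finite (nx d v)" for v by (simp add: nx_def finite_nbrs)
  have "inj_on (\<lambda>(v, x). {v, x}) (Sigma A (nx d))"
  proof (rule inj_onI, clarify)
    fix v x v' x' assume "x \<in> nx d v" "x' \<in> nx d v'" "{v, x} = {v', x'}"
    moreover have "\<not> (x mod 4 = (v + d) mod 4 \<and> v mod 4 = (x + d) mod 4)"
      by (rule mod_4_odd_antisym[OF d])
    ultimately show "v = v' \<and> x = x'" by (auto simp: doubleton_eq_iff nx_def)
  qed
  moreover have "(\<lambda>(v, x). {v, x}) ` Sigma A (nx d) \<subseteq> {e \<in> E. e \<subseteq> U}"
  proof clarify
    fix v x assume "v \<in> A" "x \<in> nx d v"
    then have "v \<in> U" "x \<in> U" "{v, x} \<in> E" using U(1) U(2)[of v] by (auto simp: nx_def nbrs_def)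
    then show "{v, x} \<in> E \<and> {v, x} \<subseteq> U" by simp
  qed
  moreover have "{e \<in> E. e \<subseteq> U} \<subseteq> Pow {..<n}" using U(3) by blast
  then have "finite {e \<in> E. e \<subseteq> U}" by (rule finite_subset) simp
  ultimately have "card (Sigma A (nx d)) \<le> card {e \<in> E. e \<subseteq> U}"
    by (rule card_inj_on_le)
  moreover have "real (card A) * (D / 2) \<le> (\<Sum>v\<in>A. real (card (nx d v)))"
    using A by (intro sum_bounded_below card_nx) blast
  moreover have "card (Sigma A (nx d)) = (\<Sum>v\<in>A. card (nx d v))"
    using fA fnx by (intro card_SigmaI) auto
  then have "(\<Sum>v\<in>A. real (card (nx d v))) = real (card (Sigma A (nx d)))" by simp
  ultimately show ?thesis by linarith
qed

text \<open>A closed set spans D / 2 edges per vertex, twice the density allowed by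
  \<open>sparse\<close>, so it has at least 4 * a vertices, and some class holds \<open>a\<close> of
  them. Their \<open>nx d\<close> neighbours stay in the set; if the class they lie in held fewer
  than \<open>a\<close>, fewer than 2 * a vertices would span a * D / 2 edges. Steps of odd length
  \<open>d\<close> reach every class.\<close>

lemma closed_set_large:
  assumes d: "odd d" and F: "F \<subseteq> Y" "F \<noteq> {}" and closed: "\<And>v. v \<in> F \<Longrightarrow> nx d v \<subseteq> F" and j: "j < 4"
  shows "card (F \<inter> res_class n j) \<ge> a"
proof -
  have Fn: "F \<subseteq> {..<n}" using F by (auto simp: Y_def)
  then have fF: "finite F" using finite_subset by blast
  have "card F > 0" using F fF by (simp add: card_gt_0_iff)
  have "4 * a \<le> card F"
  proof (rule ccontr)
    assume "\<not> 4 * a \<le> card F"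
    then have "real (card {e \<in> E. e \<subseteq> F}) < D / 4 * real (card F)"
      using sparse[OF Fn F(2)] by auto
    moreover have "real (card F) * (D / 2) \<le> real (card {e \<in> E. e \<subseteq> F})"
      using arcs_le_edges[OF d _ closed Fn F(1)] by auto
    moreover have "D / 4 * real (card F) \<le> real (card F) * (D / 2)" using D by simp
    ultimately show False by linarith
  qed
  have step: "card (F \<inter> res_class n ((i + d) mod 4)) \<ge> a" if i: "card (F \<inter> res_class n i) \<ge> a" for i
  proof (rule ccontr)
    assume N: "\<not> card (F \<inter> res_class n ((i + d) mod 4)) \<ge> a"
    obtain A where A: "A \<subseteq> F \<inter> res_class n i" "card A = a"
      using i obtain_subset_with_card_n by blast
    define U where "U = A \<union> (F \<inter> res_class n ((i + d) mod 4))"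
    have "card U \<le> a + card (F \<inter> res_class n ((i + d) mod 4))"
      using A(2) card_Un_le[of A] by (auto simp: U_def)
    then have cU: "card U < 2 * a" using N by linarith
    have Un: "U \<subseteq> {..<n}" using A Fn by (auto simp: U_def)
    have "A \<noteq> {}" using A(2) N by auto
    then have "real (card {e \<in> E. e \<subseteq> U}) < D / 4 * real (card U)"
      using sparse[OF Un] cU by (auto simp: U_def)
    also have "\<dots> \<le> D / 4 * real (2 * a)"
      using cU D by (intro mult_left_mono) auto
    also have "\<dots> = real (card A) * (D / 2)" using A(2) by simp
    also have "\<dots> \<le> real (card {e \<in> E. e \<subseteq> U})"
    proof (rule arcs_le_edges[OF d _ _ Un])
      fix v assume "v \<in> A"
      then have "v \<in> F" "v mod 4 = i" using A by (auto simp: res_class_def)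
      then show "nx d v \<subseteq> U" using closed[of v] Fn
        by (auto simp: U_def nx_def res_class_def mod_simps)
    qed (use A F in \<open>auto simp: U_def\<close>)
    finally show False by simp
  qed
  have "\<exists>i<4. card (F \<inter> res_class n i) \<ge> a"
  proof (rule ccontr)
    assume *: "\<not> ?thesis"
    have "F = (\<Union>i<4. F \<inter> res_class n i)" using Fn by (auto simp: res_class_def)
    then have "card F \<le> (\<Sum>i<4. card (F \<inter> res_class n i))"
      using card_UN_le[of "{..<4::nat}" "\<lambda>i. F \<inter> res_class n i"] by simp
    also have "\<dots> < (\<Sum>i<(4::nat). a)"
      using * by (intro sum_strict_mono) (auto simp: not_le lessThan_empty_iff)
    finally show False using \<open>4 * a \<le> card F\<close> by simp
  qed
  then obtain i where i: "i < 4" "card (F \<inter> res_class n i) \<ge> a" by auto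
  have "card (F \<inter> res_class n ((i + m * d) mod 4)) \<ge> a" for m
  proof (induction m)
    case (Suc m)
    have "((i + m * d) mod 4 + d) mod 4 = (i + Suc m * d) mod 4"
      by (simp add: mod_simps algebra_simps)
    with step[OF Suc] show ?case by simp
  qed (use i in simp)
  \<comment> \<open>Since d * d = 1 modulo 4, taking m = (j + 3 * i) * d leads to i + (j + 3 * i),
    which is j modulo 4.\<close>
  moreover have "\<exists>m. (i + m * d) mod 4 = j"
  proof (intro exI)
    have "d * d mod 4 = 1"
    proof -
      have "d mod 4 = 1 \<or> d mod 4 = 3" using d by presburger
      moreover have "d * d mod 4 = (d mod 4) * (d mod 4) mod 4" by (simp add: mod_simps)
      ultimately show ?thesis by auto
    qed
    then have "(i + (j + 3 * i) * d * d) mod 4 = (i + (j + 3 * i) * (d * d mod 4)) mod 4"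
      by (metis mod_add_right_eq mod_mult_right_eq mult.assoc)
    also have "\<dots> = (i + (j + 3 * i)) mod 4" using \<open>d * d mod 4 = 1\<close> by simp
    also have "\<dots> = j" using j by presburger
    finally show "(i + ((j + 3 * i) * d) * d) mod 4 = j" .
  qed
  ultimately show ?thesis by metis
qed

definition arcs :: "(nat \<times> nat) set" where
  "arcs = {(v, x). v \<in> Y \<and> x \<in> nx 1 v}"

text \<open>
  The vertices reachable from \<open>v\<close> and those reaching \<open>w\<close> both fill a large part of every class, so
  some edge leads from the former to the latter.
\<close>

lemma arcs_strong: assumes v: "v \<in> Y" and w: "w \<in> Y" shows "(v, w) \<in> arcs\<^sup>*"
proof -
  have nx3: "(x, v) \<in> arcs" if "x \<in> nx 3 v" "v \<in> Y" for x v
  proof -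
    have "v mod 4 = (x + 1) mod 4" using that by (intro mod_4_pred) (auto simp: nx_def)
    moreover have "v \<in> nbrs E x" using that nbrs_commute[of x E v] by (simp add: nx_def)
    ultimately show ?thesis using that by (auto simp: arcs_def nx_def)
  qed
  have sub: "arcs \<subseteq> Y \<times> Y" by (auto simp: arcs_def nx_def)
  have in_Y: "x \<in> Y \<longleftrightarrow> y \<in> Y" if "(x, y) \<in> arcs\<^sup>*" for x y
    using that by (induction rule: rtrancl_induct) (use sub in auto)
  define F where "F = {x. (v, x) \<in> arcs\<^sup>*}"
  define B where "B = {x. (x, w) \<in> arcs\<^sup>*}"
  have "F \<subseteq> Y" "F \<noteq> {}" "B \<subseteq> Y" "B \<noteq> {}"
    using in_Y v w by (auto simp: F_def B_def)
  have "card (F \<inter> res_class n 0) \<ge> a"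
    using \<open>F \<subseteq> Y\<close> by (intro closed_set_large[where d = 1] \<open>F \<noteq> {}\<close>)
      (auto simp: F_def arcs_def intro: rtrancl.rtrancl_into_rtrancl)
  moreover have "card (B \<inter> res_class n 1) \<ge> a"
    using \<open>B \<subseteq> Y\<close> by (intro closed_set_large[where d = 3] \<open>B \<noteq> {}\<close>)
      (auto simp: B_def intro: nx3 converse_rtrancl_into_rtrancl)
  ultimately obtain F' B' where F': "F' \<subseteq> F \<inter> res_class n 0" "card F' = a"
    and B': "B' \<subseteq> B \<inter> res_class n 1" "card B' = a"
    by (meson obtain_subset_with_card_n)
  have "F' \<subseteq> {..<n}" "B' \<subseteq> {..<n}" using F' B' by (auto simp: res_class_def)
  moreover have "res_class n 0 \<inter> res_class n 1 = {}" by (auto simp: res_class_def)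
  then have "F' \<inter> B' = {}" using F' B' by blast
  ultimately obtain x y where "x \<in> F'" "y \<in> B'" "{x, y} \<in> E"
    using dense F' B' by blast
  then have xy: "x \<in> F" "x mod 4 = 0" "y \<in> B" "y mod 4 = 1" "{x, y} \<in> E"
    using F' B' by (auto simp: res_class_def)
  have "(x + 1) mod 4 = 1" using xy(2) by presburger
  then have "(x, y) \<in> arcs"
    using xy \<open>F \<subseteq> Y\<close> \<open>B \<subseteq> Y\<close> by (auto simp: arcs_def nx_def nbrs_def)
  then show ?thesis using xy(1,3) by (auto simp: F_def B_def)
qed

section \<open>Attaching the remaining vertices to the core\<close>

lemma two_nbrs_same_parity:
  assumes "w \<in> Bd" "w \<notin> S"
  shows "\<exists>x y. x \<noteq> y \<and> x \<in> nbrs E w \<inter> Y \<and> y \<in> nbrs E w \<inter> Y \<and> (odd x \<longleftrightarrow> odd y)"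
proof -
  have "real (card (nbrs E w)) \<ge> D" using assms by (auto simp: low_def bad_def)
  then have "card (nbrs E w) \<ge> 12" using D by linarith
  \<comment> \<open>At most 6 of at least 12 neighbours are lost; any three integers contain two of
    equal parity.\<close>
  then have "card (nbrs E w \<inter> Y) \<ge> 3"
    using card_nbrs_Y[of w UNIV] assms Bd_less by auto
  then obtain T where T: "T \<subseteq> nbrs E w \<inter> Y" "card T = 3" by (meson obtain_subset_with_card_n)
  then obtain x y z where "T = {x, y, z}" "x \<noteq> y" "y \<noteq> z" "x \<noteq> z"
    by (auto simp: card_3_iff)
  then have "x \<in> nbrs E w \<inter> Y" "y \<in> nbrs E w \<inter> Y" "z \<in> nbrs E w \<inter> Y" using T(1) by auto
  moreover have "(odd x \<longleftrightarrow> odd y) \<or> (odd y \<longleftrightarrow> odd z) \<or> (odd x \<longleftrightarrow> odd z)" by blast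
  ultimately show ?thesis using \<open>x \<noteq> y\<close> \<open>y \<noteq> z\<close> \<open>x \<noteq> z\<close> by blast
qed

lemma two_colouring: "\<exists>c. range c \<subseteq> {0, 1} \<and> proper_connected {..<n} E c"
proof -
  have "\<exists>p. \<forall>w\<in>Bd - S. fst (p w) \<noteq> snd (p w) \<and> fst (p w) \<in> nbrs E w \<inter> Y \<and>
      snd (p w) \<in> nbrs E w \<inter> Y \<and> (odd (fst (p w)) \<longleftrightarrow> odd (snd (p w)))"
    by (intro bchoice) (use two_nbrs_same_parity in force)
  then obtain p where p: "\<And>w. w \<in> Bd \<Longrightarrow> w \<notin> S \<Longrightarrow> fst (p w) \<noteq> snd (p w) \<and>
      fst (p w) \<in> nbrs E w \<inter> Y \<and> snd (p w) \<in> nbrs E w \<inter> Y \<and>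
      (odd (fst (p w)) \<longleftrightarrow> odd (snd (p w)))" by auto
  have hub: "\<exists>x. x \<in> Y \<and> {u, x} \<in> E \<and> x mod 4 = j" if "u \<in> h ` S" "j < 4" for u j
  proof -
    have "u \<notin> Bd" "u < n"
      using that h_not_Bd h_nbr nbrs_vertex_pairs(1)[OF E] by auto
    then have "real (card (nbrs E u \<inter> Y \<inter> res_class n j)) > 0"
      using class_nbrs_Y[of u j] that(2) D by auto
    then have "nbrs E u \<inter> Y \<inter> res_class n j \<noteq> {}" by auto
    then show ?thesis by (auto simp: nbrs_def res_class_def)
  qed
  obtain x where x: "\<And>u. u \<in> h ` S \<Longrightarrow> x u \<in> Y \<and> {u, x u} \<in> E \<and> x u mod 4 = 0"
    using bchoice[of "h ` S" "\<lambda>u x. x \<in> Y \<and> {u, x} \<in> E \<and> x mod 4 = 0"] hub[of _ 0] by fastforce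
  obtain y where y: "\<And>u. u \<in> h ` S \<Longrightarrow> y u \<in> Y \<and> {u, y u} \<in> E \<and> y u mod 4 = 1"
    using bchoice[of "h ` S" "\<lambda>u x. x \<in> Y \<and> {u, x} \<in> E \<and> x mod 4 = 1"] hub[of _ 1] by fastforce
  define A where "A = arcs \<union> {(w, fst (p w)) | w. w \<in> Bd - S} \<union> {(snd (p w), w) | w. w \<in> Bd - S}"
  \<comment> \<open>A vertex outside \<open>Y\<close> takes the type opposite to its two chosen
    neighbours, whatever its own parity. Both edges then qualify as arcs, one coming from
    \<open>snd (p w)\<close> and one going to \<open>fst (p w)\<close>.\<close>
  define t where "t v = (if v \<in> Y then odd v else even (fst (p v)))" for v
  have Y: "Y \<inter> Bd = {}" by (auto simp: Y_def)
  have arcs: "{v, w} \<in> E \<and> odd v \<noteq> odd w \<and> (w, v) \<notin> arcs \<and> v \<in> Y \<and> w \<in> Y" if "(v, w) \<in> arcs" for v w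
  proof -
    have "w mod 4 = (v + 1) mod 4" using that by (auto simp: arcs_def nx_def)
    then have "odd v \<noteq> odd w" "v mod 4 \<noteq> (w + 1) mod 4"
      using mod_4_Suc_parity mod_4_odd_antisym[of 1] by (blast, force)
    then show ?thesis using that by (auto simp: arcs_def nx_def nbrs_def)
  qed
  show ?thesis
  proof (rule two_colouring_of_orientation[where Z = "Y \<union> (Bd - S)" and S = S and h = h and t = t
        and A = A and x = x and y = y])
    show "{..<n} = Y \<union> (Bd - S) \<union> h ` S \<union> S"
      using h_nbr nbrs_vertex_pairs(1)[OF E] Bd_less S_subset_Bd by (auto simp: Y_def)
    show "(Y \<union> (Bd - S)) \<inter> S = {}" "(Y \<union> (Bd - S)) \<inter> h ` S = {}" "h ` S \<inter> S = {}"
      using S_subset_Bd h_not_Bd by (auto simp: Y_def)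
    show "A \<subseteq> (Y \<union> (Bd - S)) \<times> (Y \<union> (Bd - S))"
      using arcs p by (auto simp: A_def)
    show "{v, w} \<in> E \<and> t v \<noteq> t w \<and> (w, v) \<notin> A" if vw: "(v, w) \<in> A" for v w
    proof -
      consider "(v, w) \<in> arcs" | "v \<in> Bd - S" "w = fst (p v)" | "w \<in> Bd - S" "v = snd (p w)"
        using vw by (auto simp: A_def)
      then show ?thesis
      proof cases
        case 1
        then show ?thesis using arcs[OF 1] Y by (auto simp: A_def t_def)
      next
        case 2
        then have "w \<in> Y" "v \<notin> Y" using p Y by auto
        moreover have "w \<notin> Bd" using \<open>w \<in> Y\<close> Y by auto
        ultimately show ?thesis using 2 p[of v] arcs by (auto simp: A_def t_def nbrs_def)
      next
        case 3
        then have "v \<in> Y" "w \<notin> Y" using p Y by auto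
        moreover have "v \<notin> Bd" using \<open>v \<in> Y\<close> Y by auto
        ultimately show ?thesis using 3 p[of w] arcs
          by (auto simp: A_def t_def nbrs_def insert_commute)
      qed
    qed
    show "(v, w) \<in> A\<^sup>*" if "v \<in> Y \<union> (Bd - S)" "w \<in> Y \<union> (Bd - S)" for v w
    proof -
      have *: "\<exists>v'\<in>Y. (v, v') \<in> A\<^sup>*" using that(1) p by (auto simp: A_def)
      have **: "\<exists>w'\<in>Y. (w', w) \<in> A\<^sup>*" using that(2) p by (auto simp: A_def)
      have "arcs\<^sup>* \<subseteq> A\<^sup>*" by (intro rtrancl_mono) (auto simp: A_def)
      then show ?thesis using * ** arcs_strong by (meson rtrancl_trans subsetD)
    qed
    show "x u \<in> Y \<union> (Bd - S) \<and> {u, x u} \<in> E \<and> \<not> t (x u)" if "u \<in> h ` S" for u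
    proof -
      have "x u mod 4 = 0" using x[OF that] by simp
      then have "even (x u)" by presburger
      then show ?thesis using x[OF that] by (auto simp: t_def)
    qed
    show "y u \<in> Y \<union> (Bd - S) \<and> {u, y u} \<in> E \<and> t (y u)" if "u \<in> h ` S" for u
    proof -
      have "y u mod 4 = 1" using y[OF that] by simp
      then have "odd (y u)" by presburger
      then show ?thesis using y[OF that] by (auto simp: t_def)
    qed
    show "{s, h s} \<in> E" if "s \<in> S" for s using h_nbr[OF that] by (simp add: nbrs_def)
  qed (rule inj_h)
qed

end

section \<open>Product bounds for random graphs\<close>

lemma finite_vertex_pairs: "finite V \<Longrightarrow> finite (vertex_pairs V)"
  by (rule finite_subset[of _ "Pow V"]) (auto simp: vertex_pairs_def)

lemma finite_set_pmf_gnp: "finite (set_pmf (gnp n p))"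
proof (rule finite_subset)
  show "set_pmf (gnp n p) \<subseteq> Pow (vertex_pairs {..<n})" by (auto simp: gnp_def)
qed (simp add: finite_vertex_pairs)

lemma set_pmf_gnp: "E \<in> set_pmf (gnp n p) \<Longrightarrow> E \<subseteq> vertex_pairs {..<n}"
  by (auto simp: gnp_def)

lemma expectation_gnp_prod:
  fixes f g :: "nat set \<Rightarrow> real"
  assumes p: "p \<in> {0..1}" and X: "X \<subseteq> vertex_pairs {..<n}"
    and nonneg: "\<And>e. e \<in> X \<Longrightarrow> f e \<ge> 0" "\<And>e. e \<in> X \<Longrightarrow> g e \<ge> 0"
  shows "measure_pmf.expectation (gnp n p) (\<lambda>E. \<Prod>e\<in>X. if e \<in> E then f e else g e)
    = (\<Prod>e\<in>X. p * f e + (1 - p) * g e)"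
proof -
  let ?P = "vertex_pairs {..<n}"
  \<comment> \<open>Pairs outside \<open>X\<close> get the factor 1, so the product runs over all
    trials and independence applies.\<close>
  define \<phi> where "\<phi> e b = (if e \<in> X then if b then f e else g e else 1)" for e b
  have fin: "finite ?P" by (simp add: finite_vertex_pairs)
  have restrict: "(\<Prod>e\<in>X. \<psi> e) = (\<Prod>e\<in>?P. if e \<in> X then \<psi> e else 1)" for \<psi> :: "nat set \<Rightarrow> real"
    using prod.inter_restrict[OF fin, of \<psi> X] X by (simp add: Int_absorb1)
  have eq: "(\<Prod>e\<in>X. if e \<in> {e \<in> ?P. b e} then f e else g e) = (\<Prod>e\<in>?P. \<phi> e (b e))" for b
    unfolding restrict by (intro prod.cong) (auto simp: \<phi>_def)
  have "measure_pmf.expectation (gnp n p) (\<lambda>E. \<Prod>e\<in>X. if e \<in> E then f e else g e) =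
      measure_pmf.expectation (Pi_pmf ?P False (\<lambda>_. bernoulli_pmf p)) (\<lambda>b. \<Prod>e\<in>?P. \<phi> e (b e))"
    by (simp only: gnp_def integral_map_pmf eq)
  also have "\<dots> = (\<Prod>e\<in>?P. measure_pmf.expectation (bernoulli_pmf p) (\<phi> e))"
    using nonneg by (intro expectation_prod_Pi_pmf fin integrable_measure_pmf_finite) (auto simp: \<phi>_def)
  also have "\<dots> = (\<Prod>e\<in>X. p * f e + (1 - p) * g e)"
    unfolding restrict using p by (intro prod.cong) (auto simp: \<phi>_def)
  finally show ?thesis .
qed

text \<open>Markov's inequality for a product weight, whose expectation factorises. The weights for
  a present and an absent pair are 0 and 1 to forbid edges, 1 and 0 to force them, y and 1 to bound
  the upper tail, z and 1 to bound the lower tail.\<close>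

lemma prob_gnp_le_prod:
  fixes f g :: "nat set \<Rightarrow> real"
  assumes "p \<in> {0..1}" "X \<subseteq> vertex_pairs {..<n}"
    and nonneg: "\<And>e. e \<in> X \<Longrightarrow> f e \<ge> 0" "\<And>e. e \<in> X \<Longrightarrow> g e \<ge> 0" and K: "K \<ge> 0"
    and le: "\<And>E. E \<in> \<A> \<Longrightarrow> 1 \<le> K * (\<Prod>e\<in>X. if e \<in> E then f e else g e)"
  shows "measure_pmf.prob (gnp n p) \<A> \<le> K * (\<Prod>e\<in>X. p * f e + (1 - p) * g e)"
proof -
  have "measure_pmf.prob (gnp n p) \<A> = measure_pmf.expectation (gnp n p) (indicator \<A>)" by simp
  also have "\<dots> \<le> measure_pmf.expectation (gnp n p)
      (\<lambda>E. K * (\<Prod>e\<in>X. if e \<in> E then f e else g e))"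
    using le nonneg K
    by (intro integral_mono integrable_measure_pmf_finite finite_set_pmf_gnp)
      (auto simp: indicator_def intro!: mult_nonneg_nonneg prod_nonneg)
  also have "\<dots> = K * (\<Prod>e\<in>X. p * f e + (1 - p) * g e)"
    using expectation_gnp_prod[OF assms(1,2) nonneg] by simp
  finally show ?thesis .
qed

lemma prob_gnp_no_edges:
  assumes p: "p \<in> {0..1}" and X: "X \<subseteq> vertex_pairs {..<n}"
  shows "measure_pmf.prob (gnp n p) {E. E \<inter> X = {}} \<le> exp (- p * real (card X))"
proof -
  have fin: "finite X" using X finite_vertex_pairs[of "{..<n}"] finite_subset by auto
  have "measure_pmf.prob (gnp n p) {E. E \<inter> X = {}} \<le> 1 * (\<Prod>e\<in>X. p * 0 + (1 - p) * 1)"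
  proof (rule prob_gnp_le_prod[OF p X])
    fix E assume "E \<in> {E. E \<inter> X = {}}"
    then have "(\<Prod>e\<in>X. if e \<in> E then 0 else 1) = (1 :: real)" by (intro prod.neutral) auto
    then show "(1 :: real) \<le> 1 * (\<Prod>e\<in>X. if e \<in> E then 0 else 1)" by simp
  qed auto
  also have "\<dots> = (1 - p) ^ card X" by simp
  also have "\<dots> \<le> exp (- p) ^ card X"
    using p exp_ge_add_one_self[of "- p"] by (intro power_mono) auto
  finally show ?thesis by (simp add: exp_of_nat_mult[symmetric] mult.commute)
qed

text \<open>Chernoff's upper tail, with p y + 1 - p \<le> exp (p y). The parameter \<open>y\<close>
  stays free: it will be a large constant, so that \<open>ln y\<close> outweighs the number of
  vertex sets.\<close>

lemma prob_gnp_many_edges: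
  assumes p: "p \<in> {0..1}" and X: "X \<subseteq> vertex_pairs {..<n}" and y: "y \<ge> 1"
  shows "measure_pmf.prob (gnp n p) {E. real (card (E \<inter> X)) \<ge> m}
    \<le> exp (p * y * real (card X) - m * ln y)"
proof -
  have fin: "finite X" using X finite_vertex_pairs[of "{..<n}"] finite_subset by auto
  have "measure_pmf.prob (gnp n p) {E. real (card (E \<inter> X)) \<ge> m}
      \<le> y powr (- m) * (\<Prod>e\<in>X. p * y + (1 - p) * 1)"
  proof (rule prob_gnp_le_prod[OF p X])
    fix E assume E: "E \<in> {E. real (card (E \<inter> X)) \<ge> m}"
    have "(\<Prod>e\<in>X. if e \<in> E then y else 1) = y ^ card (E \<inter> X)"
      using prod.inter_restrict[OF fin, of "\<lambda>_. y" E] by (simp add: Int_commute)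
    also have "\<dots> = y powr real (card (E \<inter> X))" using y by (simp add: powr_realpow)
    finally have "y powr (- m) * (\<Prod>e\<in>X. if e \<in> E then y else 1) = y powr (real (card (E \<inter> X)) - m)"
      by (simp add: powr_add[symmetric])
    then show "1 \<le> y powr (- m) * (\<Prod>e\<in>X. if e \<in> E then y else 1)"
      using E y by (simp add: ge_one_powr_ge_zero)
  qed (use y in auto)
  also have "(\<Prod>e\<in>X. p * y + (1 - p) * 1) = (p * y + (1 - p)) ^ card X" by simp
  also have "\<dots> \<le> exp (p * y) ^ card X"
  proof (rule power_mono)
    show "p * y + (1 - p) \<le> exp (p * y)"
      using p exp_ge_add_one_self[of "p * y"] unfolding atLeastAtMost_iff by linarith
  qed (use p y in auto)
  also have "\<dots> = exp (p * y * real (card X))" by (simp add: exp_of_nat_mult[symmetric] mult.commute)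
  also have "y powr (- m) = exp (- m * ln y)" using y by (simp add: powr_def)
  finally show ?thesis using y by (simp add: exp_add[symmetric] algebra_simps)
qed

text \<open>Exponential Markov inequality for the weight \<open>z\<close> raised to the number of edges present.\<close>

lemma prob_gnp_low_degrees:
  fixes U :: "nat \<Rightarrow> nat set" and z D :: real
  assumes p: "p \<in> {0..1}" and z: "0 < z" "z < 1"
    and W: "W \<subseteq> {..<n}" and F: "F \<subseteq> vertex_pairs W" and A: "A \<subseteq> W"
    and U: "\<And>w. w \<in> A \<Longrightarrow> U w \<subseteq> {..<n} - W"
  shows "measure_pmf.prob (gnp n p) {E. F \<subseteq> E \<and> (\<forall>w\<in>A. real (card {x \<in> U w. {w, x} \<in> E}) < D)}
    \<le> p ^ card F * (\<Prod>w\<in>A. exp (- D * ln z - p * (1 - z) * real (card (U w))))"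
proof -
  let ?star = "\<lambda>w. (\<lambda>x. {w, x}) ` U w"
  define X where "X = F \<union> (\<Union>w\<in>A. ?star w)"
  define f where "f e = (if e \<in> F then 1 else z)" for e
  define g :: "nat set \<Rightarrow> real" where "g e = (if e \<in> F then 0 else 1)" for e
  have "finite W" using W finite_subset by blast
  then have fin: "finite A" "finite F" "\<And>w. w \<in> A \<Longrightarrow> finite (U w)"
    using A F finite_vertex_pairs[of W] finite_subset[OF U] by (auto intro: finite_subset)
  have star_F: "{w, x} \<notin> F" if "w \<in> A" "x \<in> U w" for w x
  proof
    assume "{w, x} \<in> F"
    then have "x \<in> W" using F by (auto simp: vertex_pairs_def)
    then show False using U that by auto
  qed
  \<comment> \<open>\<open>F\<close> lies inside \<open>W\<close>, and each star joins one vertex of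
    \<open>W\<close> to vertices outside \<open>W\<close>. No pair occurs twice, so the weight
    factorises over forced edges and stars.\<close>
  have split: "(\<Prod>e\<in>X. \<psi> e) = (\<Prod>e\<in>F. \<psi> e) * (\<Prod>w\<in>A. \<Prod>x\<in>U w. \<psi> {w, x})" for \<psi> :: "nat set \<Rightarrow> real"
  proof -
    have "(\<Prod>e\<in>X. \<psi> e) = (\<Prod>e\<in>F. \<psi> e) * (\<Prod>e\<in>(\<Union>w\<in>A. ?star w). \<psi> e)"
      unfolding X_def using star_F fin by (intro prod.union_disjoint) auto
    also have "(\<Prod>e\<in>(\<Union>w\<in>A. ?star w). \<psi> e) = (\<Prod>w\<in>A. \<Prod>e\<in>?star w. \<psi> e)"
    proof (intro prod.UNION_disjoint ballI impI fin)
      fix v w assume "v \<in> A" "w \<in> A" "v \<noteq> w"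
      then show "?star v \<inter> ?star w = {}" using U A by (fastforce simp: doubleton_eq_iff)
    qed (use fin in auto)
    also have "\<dots> = (\<Prod>w\<in>A. \<Prod>x\<in>U w. \<psi> {w, x})"
      by (intro prod.cong refl, subst prod.reindex) (auto simp: inj_on_def doubleton_eq_iff)
    finally show ?thesis .
  qed
  have X: "X \<subseteq> vertex_pairs {..<n}"
    using F W A U by (fastforce simp: X_def vertex_pairs_def card_insert_if)
  have "measure_pmf.prob (gnp n p) {E. F \<subseteq> E \<and> (\<forall>w\<in>A. real (card {x \<in> U w. {w, x} \<in> E}) < D)}
      \<le> (\<Prod>w\<in>A. z powr (- D)) * (\<Prod>e\<in>X. p * f e + (1 - p) * g e)"
  proof (rule prob_gnp_le_prod[OF p X])
    fix E assume "E \<in> {E. F \<subseteq> E \<and> (\<forall>w\<in>A. real (card {x \<in> U w. {w, x} \<in> E}) < D)}"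
    then have E: "F \<subseteq> E" "\<And>w. w \<in> A \<Longrightarrow> real (card {x \<in> U w. {w, x} \<in> E}) < D" by auto
    have "(\<Prod>e\<in>F. if e \<in> E then f e else g e) = 1"
      using E(1) by (intro prod.neutral) (auto simp: f_def)
    moreover have "(\<Prod>x\<in>U w. if {w, x} \<in> E then f {w, x} else g {w, x})
        = z powr real (card {x \<in> U w. {w, x} \<in> E})" if w: "w \<in> A" for w
    proof -
      have "(\<Prod>x\<in>U w. if {w, x} \<in> E then f {w, x} else g {w, x}) =
          (\<Prod>x\<in>U w. if {w, x} \<in> E then z else 1)"
        using star_F[OF w] by (intro prod.cong) (auto simp: f_def g_def)
      also have "\<dots> = z ^ card {x \<in> U w. {w, x} \<in> E}"
        using prod.inter_filter[OF fin(3)[OF w], of "\<lambda>_. z" "\<lambda>x. {w, x} \<in> E"] by simp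
      finally show ?thesis using z by (simp add: powr_realpow)
    qed
    ultimately have eq: "(\<Prod>w\<in>A. z powr (- D)) * (\<Prod>e\<in>X. if e \<in> E then f e else g e) =
        (\<Prod>w\<in>A. z powr (real (card {x \<in> U w. {w, x} \<in> E}) - D))"
      by (simp add: split powr_diff divide_inverse powr_minus prod.distrib mult.commute power_inverse)
    have "1 \<le> (\<Prod>w\<in>A. z powr (real (card {x \<in> U w. {w, x} \<in> E}) - D))"
    proof (intro prod_ge_1)
      fix w assume "w \<in> A"
      then have "real (card {x \<in> U w. {w, x} \<in> E}) - D \<le> 0" using E(2)[of w] by simp
      then show "1 \<le> z powr (real (card {x \<in> U w. {w, x} \<in> E}) - D)"
        using powr_mono'[of _ 0 z] z by auto
    qed
    then show "1 \<le> (\<Prod>w\<in>A. z powr (- D)) * (\<Prod>e\<in>X. if e \<in> E then f e else g e)"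
      unfolding eq .
  qed (use z in \<open>auto simp: f_def g_def intro: prod_nonneg\<close>)
  also have "(\<Prod>e\<in>X. p * f e + (1 - p) * g e) = p ^ card F * (\<Prod>w\<in>A. (1 - p * (1 - z)) ^ card (U w))"
  proof -
    have "(\<Prod>e\<in>F. p * f e + (1 - p) * g e) = p ^ card F" by (simp add: f_def g_def)
    moreover have "(\<Prod>x\<in>U w. p * f {w, x} + (1 - p) * g {w, x}) = (1 - p * (1 - z)) ^ card (U w)"
      if "w \<in> A" for w
    proof -
      have "(\<Prod>x\<in>U w. p * f {w, x} + (1 - p) * g {w, x}) = (\<Prod>x\<in>U w. 1 - p * (1 - z))"
        using star_F[OF that] by (intro prod.cong) (auto simp: f_def g_def algebra_simps)
      then show ?thesis by simp
    qed
    ultimately show ?thesis by (simp add: split)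
  qed
  also have "(\<Prod>w\<in>A. z powr (- D)) * (p ^ card F * (\<Prod>w\<in>A. (1 - p * (1 - z)) ^ card (U w)))
      = p ^ card F * (\<Prod>w\<in>A. z powr (- D) * (1 - p * (1 - z)) ^ card (U w))"
    by (simp add: prod.distrib)
  also have "\<dots> \<le> p ^ card F * (\<Prod>w\<in>A. exp (- D * ln z - p * (1 - z) * real (card (U w))))"
  proof (intro mult_left_mono prod_mono conjI)
    fix w
    have "p * (1 - z) \<le> 1" using p z mult_mono[of p 1 "1 - z" 1] by auto
    then show "0 \<le> z powr (- D) * (1 - p * (1 - z)) ^ card (U w)" by simp
    have "(1 - p * (1 - z)) ^ card (U w) \<le> exp (- (p * (1 - z))) ^ card (U w)"
      using \<open>p * (1 - z) \<le> 1\<close> exp_ge_add_one_self[of "- (p * (1 - z))"] by (intro power_mono) auto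
    also have "\<dots> = exp (- (p * (1 - z) * real (card (U w))))"
      by (simp add: exp_of_nat_mult[symmetric] mult.commute)
    finally have "z powr (- D) * (1 - p * (1 - z)) ^ card (U w)
        \<le> z powr (- D) * exp (- (p * (1 - z) * real (card (U w))))"
      by (intro mult_left_mono) auto
    then show "z powr (- D) * (1 - p * (1 - z)) ^ card (U w)
        \<le> exp (- D * ln z - p * (1 - z) * real (card (U w)))"
      using z by (simp add: powr_def exp_add[symmetric])
  qed (use p in simp)
  finally show ?thesis .
qed

lemma prob_gnp_mono:
  assumes pq: "0 \<le> p" "p \<le> q" "q \<le> 1" and mono: "\<And>E E'. E \<in> \<A> \<Longrightarrow> E \<subseteq> E' \<Longrightarrow> E' \<in> \<A>"
  shows "measure_pmf.prob (gnp n p) \<A> \<le> measure_pmf.prob (gnp n q) \<A>"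
proof -
  let ?P = "vertex_pairs {..<n}"
  \<comment> \<open>For q = 0 also p = 0, so the default value satisfies q * r = p as well.\<close>
  define r where "r = (if q = 0 then 0 else p / q)"
  have r: "0 \<le> r" "r \<le> 1" "q * r = p" using pq by (auto simp: r_def divide_le_eq)
  \<comment> \<open>coupling of a \<open>p\<close>-coin and a \<open>q\<close>-coin: thin the \<open>q\<close>-coin by an independent \<open>r\<close>-coin\<close>
  define C where "C = bind_pmf (bernoulli_pmf q)
    (\<lambda>b. map_pmf (\<lambda>c. (c, b)) (if b then bernoulli_pmf r else return_pmf False))"
  have "map_pmf fst C = bind_pmf (bernoulli_pmf q) (\<lambda>b. if b then bernoulli_pmf r else return_pmf False)"
    unfolding C_def map_bind_pmf pmf.map_comp o_def fst_conv by (simp add: pmf.map_ident)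
  then have "pmf (map_pmf fst C) True = p"
    using pq r by (simp add: pmf_bind mult.commute)
  then have C1: "map_pmf fst C = bernoulli_pmf p"
    using pq by (intro pmf_eqI) (metis (full_types) pmf_bernoulli_True pmf_False_conv_True order_trans)
  have C2: "map_pmf snd C = bernoulli_pmf q"
    by (simp add: C_def map_bind_pmf pmf.map_comp o_def map_pmf_const bind_return_pmf')
  have C_le: "fst x \<Longrightarrow> snd x" if "x \<in> set_pmf C" for x
    using that by (auto simp: C_def split: if_splits)
  have fin: "finite ?P" by (simp add: finite_vertex_pairs)
  define M where "M = Pi_pmf ?P (False, False) (\<lambda>_. C)"
  have eq: "gnp n p = map_pmf (\<lambda>b. {e \<in> ?P. fst (b e)}) M" "gnp n q = map_pmf (\<lambda>b. {e \<in> ?P. snd (b e)}) M"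
    unfolding gnp_def M_def C1[symmetric] C2[symmetric]
    by (simp_all add: Pi_pmf_map[OF fin, of fst "(False, False)"] Pi_pmf_map[OF fin, of snd "(False, False)"]
        pmf.map_comp o_def)
  have "measure_pmf.prob M {b. {e \<in> ?P. fst (b e)} \<in> \<A>} \<le> measure_pmf.prob M {b. {e \<in> ?P. snd (b e)} \<in> \<A>}"
  proof (rule measure_pmf.finite_measure_mono_AE)
    have "{e \<in> ?P. fst (b e)} \<subseteq> {e \<in> ?P. snd (b e)}" if "b \<in> set_pmf M" for b
    proof clarify
      fix e assume e: "e \<in> ?P" "fst (b e)"
      then have "b e \<in> set_pmf C" using that by (auto simp: M_def set_Pi_pmf fin PiE_dflt_def)
      then show "snd (b e)" using C_le e by blast
    qed
    then show "AE b in M. b \<in> {b. {e \<in> ?P. fst (b e)} \<in> \<A>} \<longrightarrow> b \<in> {b. {e \<in> ?P. snd (b e)} \<in> \<A>}"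
      using mono by (auto simp: AE_measure_pmf_iff)
  qed auto
  then show ?thesis by (simp add: eq vimage_def)
qed

section \<open>First moment estimates\<close>

lemma prob_union_bound:
  assumes "finite I" "A \<subseteq> (\<Union>i\<in>I. F i)" "\<And>i. i \<in> I \<Longrightarrow> measure_pmf.prob M (F i) \<le> b"
  shows "measure_pmf.prob M A \<le> real (card I) * b"
proof -
  have "measure_pmf.prob M A \<le> measure_pmf.prob M (\<Union>i\<in>I. F i)"
    using assms(2) by (intro measure_pmf.finite_measure_mono) auto
  also have "\<dots> \<le> (\<Sum>i\<in>I. measure_pmf.prob M (F i))"
    using assms(1) by (intro measure_pmf.finite_measure_subadditive_finite) auto
  also have "\<dots> \<le> real (card I) * b"
    using assms(3) sum_bounded_above[of I "\<lambda>i. measure_pmf.prob M (F i)" b] by simp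
  finally show ?thesis .
qed

lemma path_edges_subset: "distinct vs \<Longrightarrow> set (path_edges vs) \<subseteq> vertex_pairs (set vs)"
  by (induction vs rule: path_edges.induct) (auto simp: vertex_pairs_def)

lemma card_path_edges: "distinct vs \<Longrightarrow> card (set (path_edges vs)) = length vs - 1"
proof (induction vs rule: path_edges.induct)
  case (1 u v vs)
  have "{u, v} \<notin> set (path_edges (v # vs))"
    using 1(2) path_edges_subset[of "v # vs"] by (auto simp: vertex_pairs_def)
  then show ?case using 1 by simp
qed auto

lemma card_res_class: assumes "j < 4" shows "real (card (res_class n j)) \<ge> real n / 4 - 1"
proof -
  have "(\<lambda>i. 4 * i + j) ` {..<n div 4} \<subseteq> res_class n j"
    using assms by (auto simp: res_class_def)
  then have "card {..<n div 4} \<le> card (res_class n j)"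
    by (intro card_inj_on_le[where f = "\<lambda>i. 4 * i + j"]) (auto simp: inj_on_def res_class_def)
  then show ?thesis by simp
qed

lemma card_Diff_real: "finite B \<Longrightarrow> real (card (A - B)) \<ge> real (card A) - real (card B)"
  using diff_card_le_card_Diff[of B A] by linarith

section \<open>Probabilities of the exceptional events\<close>

lemma prob_isolated:
  assumes p: "p \<in> {0..1}"
  shows "measure_pmf.prob (gnp n p) {E. \<exists>v<n. nbrs E v = {}} \<le> real n * exp (- p * (real n - 1))"
proof -
  have "measure_pmf.prob (gnp n p) {E. \<exists>v<n. nbrs E v = {}} \<le> real (card {..<n}) * exp (- p * (real n - 1))"
  proof (rule prob_union_bound)
    fix v assume v: "v \<in> {..<n}"
    let ?X = "(\<lambda>x. {v, x}) ` ({..<n} - {v})"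
    have "card ?X = card ({..<n} - {v})" by (intro card_image) (auto simp: inj_on_def doubleton_eq_iff)
    then have "real (card ?X) = real n - 1" using v by simp
    moreover have "?X \<subseteq> vertex_pairs {..<n}" using v by (auto simp: vertex_pairs_def)
    ultimately show "measure_pmf.prob (gnp n p) {E. E \<inter> ?X = {}} \<le> exp (- p * (real n - 1))"
      using prob_gnp_no_edges[OF p, of ?X n] by simp
  qed (auto simp: nbrs_def)
  then show ?thesis by simp
qed

text \<open>The vertices of the path are not counted as neighbours of its ends. This only lowers
  degrees, and it makes the two deficiencies and the presence of the path independent. The tilt is z
  = 1/10, whence \<open>ln 10\<close> and 9/10; the factor 4 chooses the deficient class of the last
  vertex.\<close>

lemma prob_low_near_bad:
  assumes p: "p \<in> {0..1}" and l: "2 \<le> l"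
  shows "measure_pmf.prob (gnp n p) {E. E \<subseteq> vertex_pairs {..<n} \<and> (\<exists>vs. distinct vs \<and> length vs = l \<and>
      set vs \<subseteq> {..<n} \<and> set (path_edges vs) \<subseteq> E \<and> hd vs \<in> low n E D \<and> last vs \<in> bad n E D)}
    \<le> real (n ^ l * 4) * (p ^ (l - 1) *
        (exp (D * ln 10 - 9/10 * p * (real n - real l)) * exp (D * ln 10 - 9/10 * p * (real n / 4 - 1 - real l))))"
    (is "measure_pmf.prob _ ?\<A> \<le> _ * ?b")
proof -
  define L where "L = {vs. set vs \<subseteq> {..<n} \<and> length vs = l}"
  define I where "I = {vs \<in> L. distinct vs} \<times> {..<4::nat}"
  define U where "U vs j w = (if w = hd vs then {..<n} - set vs else res_class n j - set vs)" for vs j w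
  define F where "F = (\<lambda>(vs, j). {E. set (path_edges vs) \<subseteq> E \<and>
      (\<forall>w\<in>{hd vs, last vs}. real (card {x \<in> U vs j w. {w, x} \<in> E}) < D)})"
  have L: "finite L" "card L = n ^ l"
    using finite_lists_length_eq[of "{..<n}" l] card_lists_length_eq[of "{..<n}" l] by (auto simp: L_def)
  have "measure_pmf.prob (gnp n p) ?\<A> \<le> real (card I) * ?b"
  proof (rule prob_union_bound)
    show "finite I" using L by (simp add: I_def)
    show "?\<A> \<subseteq> (\<Union>i\<in>I. F i)"
    proof
      fix E assume "E \<in> ?\<A>"
      then obtain vs where E: "E \<subseteq> vertex_pairs {..<n}" and vs: "distinct vs" "length vs = l" "set vs \<subseteq> {..<n}"
        "set (path_edges vs) \<subseteq> E" "hd vs \<in> low n E D" "last vs \<in> bad n E D" by blast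
      obtain j where j: "j < 4" "real (card (nbrs E (last vs) \<inter> res_class n j)) < D"
        using vs(6) by (auto simp: bad_def)
      have fin: "finite (nbrs E v)" for v
        using nbrs_vertex_pairs(1)[OF E] by (meson finite_lessThan finite_subset subsetI)
      have "card {x \<in> U vs j (hd vs). {hd vs, x} \<in> E} \<le> card (nbrs E (hd vs))"
        by (intro card_mono fin) (auto simp: nbrs_def)
      then have "real (card {x \<in> U vs j (hd vs). {hd vs, x} \<in> E}) < D"
        using vs(5) by (simp add: low_def)
      moreover have "hd vs \<noteq> last vs"
        using vs(1,2) l by (cases vs) auto
      then have "card {x \<in> U vs j (last vs). {last vs, x} \<in> E} \<le> card (nbrs E (last vs) \<inter> res_class n j)"
        by (intro card_mono finite_Int disjI1 fin) (auto simp: nbrs_def U_def)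
      then have "real (card {x \<in> U vs j (last vs). {last vs, x} \<in> E}) < D"
        using j by linarith
      ultimately have "E \<in> F (vs, j)" "(vs, j) \<in> I"
        using vs j by (auto simp: F_def I_def L_def)
      then show "E \<in> (\<Union>i\<in>I. F i)" by blast
    qed
    fix i assume "i \<in> I"
    then obtain vs j where i: "i = (vs, j)" "distinct vs" "set vs \<subseteq> {..<n}" "length vs = l" "j < 4"
      by (auto simp: I_def L_def)
    have ne: "hd vs \<noteq> last vs" "vs \<noteq> []" using i l by (cases vs; auto)+
    have cvs: "card (set vs) = l" using i by (simp add: distinct_card)
    have "measure_pmf.prob (gnp n p) (F i) \<le> p ^ card (set (path_edges vs)) *
      (\<Prod>w\<in>{hd vs, last vs}. exp (- D * ln (1/10) - p * (1 - 1/10) * real (card (U vs j w))))"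
      unfolding i(1) F_def prod.case
      by (rule prob_gnp_low_degrees[OF p])
        (use i ne path_edges_subset[of vs] in \<open>auto simp: U_def res_class_def\<close>)
    also have "\<dots> = p ^ (l - 1) * (exp (D * ln 10 - 9/10 * p * real (card (U vs j (hd vs)))) *
        exp (D * ln 10 - 9/10 * p * real (card (U vs j (last vs)))))"
      using ne i by (simp add: card_path_edges ln_div mult.commute)
    also have "\<dots> \<le> ?b"
    proof -
      have "real (card (U vs j (hd vs))) \<ge> real n - real l"
        using card_Diff_real[of "set vs" "{..<n}"] cvs by (simp add: U_def)
      moreover have "real (card (U vs j (last vs))) \<ge> real n / 4 - 1 - real l"
        using card_Diff_real[of "set vs" "res_class n j"] cvs ne card_res_class[OF i(5), of n]
        by (simp add: U_def)
      ultimately show ?thesis using p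
        by (intro mult_left_mono mult_mono) (auto intro!: mult_left_mono)
    qed
    finally show "measure_pmf.prob (gnp n p) (F i) \<le> ?b" .
  qed
  also have "real (card I) * ?b \<le> real (n ^ l * 4) * ?b"
  proof (rule mult_right_mono)
    have "card I \<le> card L * 4"
      using card_mono[of L "{vs \<in> L. distinct vs}"] L by (auto simp: I_def card_cartesian_product)
    then show "real (card I) \<le> real (n ^ l * 4)" using L by (metis of_nat_mono)
  qed (use p in simp)
  finally show ?thesis .
qed

lemma card_subsets_le: "card {T. T \<subseteq> {..<n} \<and> card T = k} \<le> n ^ k"
proof (cases "k \<le> n")
  case True
  then show ?thesis using binomial_le_pow[of k n] n_subsets[of "{..<n}" k] by simp
next
  case False
  then have "card {T. T \<subseteq> {..<n} \<and> card T = k} = 0"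
    by (subst n_subsets) (simp_all add: binomial_eq_0)
  then show ?thesis by linarith
qed

lemma finite_subsets_card: "finite {T. T \<subseteq> {..<n::nat} \<and> card T = k}"
  by (rule finite_subset[of _ "Pow {..<n}"]) auto

text \<open>Six bad neighbours are fixed with a deficient class for each, in 4 ^ 6 ways. Discarding
  \<open>v\<close> and all six from the classes makes the deficiencies independent; a class of at
  least n / 4 - 1 vertices loses at most 7.\<close>

lemma prob_many_bad_nbrs:
  assumes p: "p \<in> {0..1}"
  shows "measure_pmf.prob (gnp n p) {E. E \<subseteq> vertex_pairs {..<n} \<and>
      (\<exists>v<n. \<not> card (nbrs E v \<inter> bad n E D) \<le> 5)}
    \<le> real n * (real (n ^ 6) * (4 ^ 6 * (p ^ 6 * exp (D * ln 10 - 9/10 * p * (real n / 4 - 8)) ^ 6)))"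
    (is "measure_pmf.prob _ ?\<A> \<le> _ * (_ * (_ * ?b))")
proof -
  define U where "U v T j w = res_class n (j w) - insert v T" for v :: nat and T j and w :: nat
  define F where "F v T j = {E. (\<lambda>w. {v, w}) ` T \<subseteq> E \<and>
      (\<forall>w\<in>T. real (card {x \<in> U v T j w. {w, x} \<in> E}) < D)}" for v T j
  define \<T> where "\<T> v = {T. T \<subseteq> {..<n} \<and> card T = 6 \<and> v \<notin> T}" for v
  define J where "J T = PiE T (\<lambda>_. {..<4::nat})" for T :: "nat set"
  have b: "0 \<le> ?b" using p by simp
  have \<T>: "finite (\<T> v)" "card (\<T> v) \<le> n ^ 6" for v
  proof -
    have "\<T> v \<subseteq> {T. T \<subseteq> {..<n} \<and> card T = 6}" by (auto simp: \<T>_def)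
    then show "finite (\<T> v)" "card (\<T> v) \<le> n ^ 6"
      using finite_subsets_card card_subsets_le[of n 6] card_mono finite_subset by (blast, meson le_trans)
  qed
  have fT: "finite T" if "T \<in> \<T> v" for T v
    using that finite_subset[of T "{..<n}"] by (auto simp: \<T>_def)
  have 1: "measure_pmf.prob (gnp n p) (F v T j) \<le> ?b" if v: "v < n" and T: "T \<in> \<T> v" and j: "j \<in> J T" for v T j
  proof -
    have cT: "card (insert v T) = 7" using T fT[OF T] by (auto simp: \<T>_def)
    have "measure_pmf.prob (gnp n p) (F v T j) \<le> p ^ card ((\<lambda>w. {v, w}) ` T) *
      (\<Prod>w\<in>T. exp (- D * ln (1/10) - p * (1 - 1/10) * real (card (U v T j w))))"
      unfolding F_def
      by (rule prob_gnp_low_degrees[where W = "insert v T", OF p])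
        (use v T in \<open>auto simp: U_def res_class_def \<T>_def vertex_pairs_def card_insert_if\<close>)
    also have "card ((\<lambda>w. {v, w}) ` T) = 6"
      using T card_image[of "\<lambda>w. {v, w}" T] by (auto simp: \<T>_def inj_on_def doubleton_eq_iff)
    also have "(\<Prod>w\<in>T. exp (- D * ln (1/10) - p * (1 - 1/10) * real (card (U v T j w))))
        \<le> (\<Prod>w\<in>T. exp (D * ln 10 - 9/10 * p * (real n / 4 - 8)))"
    proof (intro prod_mono conjI)
      fix w assume w: "w \<in> T"
      have "real (card (U v T j w)) \<ge> real n / 4 - 8"
        using card_Diff_real[of "insert v T" "res_class n (j w)"] cT fT[OF T]
          card_res_class[of "j w" n] j w by (auto simp: U_def J_def PiE_def Pi_def)
      then have "p * (real n / 4 - 8) \<le> p * real (card (U v T j w))"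
        using p by (intro mult_left_mono) auto
      then show "exp (- D * ln (1/10) - p * (1 - 1/10) * real (card (U v T j w)))
          \<le> exp (D * ln 10 - 9/10 * p * (real n / 4 - 8))"
        by (simp add: ln_div mult.commute)
    qed simp
    also have "\<dots> = exp (D * ln 10 - 9/10 * p * (real n / 4 - 8)) ^ 6"
      using T by (simp add: \<T>_def)
    finally show ?thesis using p by (simp add: mult_left_mono)
  qed
  have 2: "measure_pmf.prob (gnp n p) (\<Union>j\<in>J T. F v T j) \<le> 4 ^ 6 * ?b" if v: "v < n" and T: "T \<in> \<T> v" for v T
  proof -
    have "card (J T) = 4 ^ 6"
      using T fT[OF T] by (simp add: J_def card_PiE \<T>_def)
    then show ?thesis
      using prob_union_bound[of "J T" _ "F v T" "gnp n p" ?b] 1[OF v T] fT[OF T]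
      by (simp add: J_def finite_PiE)
  qed
  have 3: "measure_pmf.prob (gnp n p) (\<Union>T\<in>\<T> v. \<Union>j\<in>J T. F v T j) \<le> real (n ^ 6) * (4 ^ 6 * ?b)"
    if v: "v < n" for v
  proof -
    have "measure_pmf.prob (gnp n p) (\<Union>T\<in>\<T> v. \<Union>j\<in>J T. F v T j) \<le> real (card (\<T> v)) * (4 ^ 6 * ?b)"
      using \<T> 2[OF v] by (intro prob_union_bound[OF _ subset_refl]) auto
    also have "\<dots> \<le> real (n ^ 6) * (4 ^ 6 * ?b)"
      using \<T>[of v] b by (intro mult_right_mono) (auto simp flip: of_nat_power)
    finally show ?thesis .
  qed
  have "?\<A> \<subseteq> (\<Union>v\<in>{..<n}. \<Union>T\<in>\<T> v. \<Union>j\<in>J T. F v T j)"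
  proof
    fix E assume "E \<in> ?\<A>"
    then obtain v where E: "E \<subseteq> vertex_pairs {..<n}" and "v < n" "\<not> card (nbrs E v \<inter> bad n E D) \<le> 5"
      by blast
    then have v: "v < n" "6 \<le> card (nbrs E v \<inter> bad n E D)" by simp_all
    obtain T where T: "T \<subseteq> nbrs E v \<inter> bad n E D" "card T = 6"
      by (meson obtain_subset_with_card_n v(2))
    have fin: "finite (nbrs E v)" for v
      using nbrs_vertex_pairs(1)[OF E] by (meson finite_lessThan finite_subset subsetI)
    have "\<forall>w\<in>T. \<exists>j. j < 4 \<and> real (card (nbrs E w \<inter> res_class n j)) < D"
      using T by (auto simp: bad_def)
    then obtain j where j: "\<And>w. w \<in> T \<Longrightarrow> j w < 4 \<and> real (card (nbrs E w \<inter> res_class n (j w))) < D"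
      by metis
    have "real (card {x \<in> U v T (restrict j T) w. {w, x} \<in> E}) < D" if w: "w \<in> T" for w
    proof -
      have "card {x \<in> U v T (restrict j T) w. {w, x} \<in> E} \<le> card (nbrs E w \<inter> res_class n (j w))"
        using w by (intro card_mono finite_Int disjI1 fin) (auto simp: nbrs_def U_def)
      then show ?thesis using j[OF w] by linarith
    qed
    then have "E \<in> F v T (restrict j T)" using T by (auto simp: F_def nbrs_def)
    moreover have "T \<subseteq> {..<n}" "v \<notin> T"
      using T(1) nbrs_vertex_pairs(1,3)[OF E] by blast+
    then have "T \<in> \<T> v" using T(2) by (simp add: \<T>_def)
    moreover have "restrict j T \<in> J T" using j by (auto simp: J_def)
    ultimately show "E \<in> (\<Union>v\<in>{..<n}. \<Union>T\<in>\<T> v. \<Union>j\<in>J T. F v T j)" using v by blast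
  qed
  then show ?thesis
    using prob_union_bound[of "{..<n}" ?\<A> _ "gnp n p", OF _ _ 3] by simp
qed

text \<open>All a * a pairs between the sets are absent. Counting the pairs of sets crudely by 4 ^ n
  is affordable, because p * a * a is of order n ln n once \<open>a\<close> is linear in n.\<close>

lemma prob_not_dense:
  assumes p: "p \<in> {0..1}"
  shows "measure_pmf.prob (gnp n p) {E. \<exists>A B. A \<subseteq> {..<n} \<and> B \<subseteq> {..<n} \<and> A \<inter> B = {} \<and>
      card A = a \<and> card B = a \<and> \<not> (\<exists>x\<in>A. \<exists>y\<in>B. {x, y} \<in> E)} \<le> 4 ^ n * exp (- p * real (a * a))"
    (is "measure_pmf.prob _ ?\<A> \<le> _")
proof -
  define I where "I = {(A, B). A \<subseteq> {..<n} \<and> B \<subseteq> {..<n} \<and> A \<inter> B = {} \<and> card A = a \<and> card B = a}"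
  define X where "X = (\<lambda>(A, B). (\<lambda>(x, y). {x, y}) ` (A \<times> B :: (nat \<times> nat) set))"
  have I: "I \<subseteq> Pow {..<n} \<times> Pow {..<n}" by (auto simp: I_def)
  then have fin: "finite I" by (rule finite_subset) simp
  have "measure_pmf.prob (gnp n p) ?\<A> \<le> real (card I) * exp (- p * real (a * a))"
  proof (rule prob_union_bound[OF fin])
    show "?\<A> \<subseteq> (\<Union>i\<in>I. {E. E \<inter> X i = {}})"
    proof
      fix E assume "E \<in> ?\<A>"
      then obtain A B where "(A, B) \<in> I" and no_edge: "\<not> (\<exists>x\<in>A. \<exists>y\<in>B. {x, y} \<in> E)"
        by (auto simp: I_def)
      moreover have "E \<inter> X (A, B) = {}" using no_edge by (auto simp: X_def)
      ultimately show "E \<in> (\<Union>i\<in>I. {E. E \<inter> X i = {}})" by blast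
    qed
    fix i assume "i \<in> I"
    then obtain A B where i: "i = (A, B)" "A \<subseteq> {..<n}" "B \<subseteq> {..<n}" "A \<inter> B = {}" "card A = a" "card B = a"
      by (auto simp: I_def)
    have "inj_on (\<lambda>(x, y). {x, y}) (A \<times> B)"
      using i(4) by (auto simp: inj_on_def doubleton_eq_iff)
    then have "card (X i) = a * a" using i by (simp add: X_def card_image card_cartesian_product)
    moreover have "X i \<subseteq> vertex_pairs {..<n}"
      using i by (auto simp: X_def vertex_pairs_def card_insert_if)
    ultimately show "measure_pmf.prob (gnp n p) {E. E \<inter> X i = {}} \<le> exp (- p * real (a * a))"
      using prob_gnp_no_edges[OF p, of "X i" n] by simp
  qed
  also have "\<dots> \<le> 4 ^ n * exp (- p * real (a * a))"
  proof (rule mult_right_mono)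
    have "card I \<le> card (Pow {..<n} \<times> Pow {..<n})" by (intro card_mono I) auto
    also have "\<dots> = 4 ^ n" by (simp add: card_cartesian_product card_Pow flip: power_mult_distrib)
    finally have "real (card I) \<le> real (4 ^ n)" by (rule of_nat_mono)
    then show "real (card I) \<le> 4 ^ n" by simp
  qed simp
  finally show ?thesis .
qed

lemma prob_dense_subset:
  assumes p: "p \<in> {0..1}" and y: "y \<ge> 1"
  shows "measure_pmf.prob (gnp n p) {E. E \<subseteq> vertex_pairs {..<n} \<and> (\<exists>U. U \<subseteq> {..<n} \<and> U \<noteq> {} \<and> card U = r \<and>
      \<not> real (card {e \<in> E. e \<subseteq> U}) < m)} \<le> real (n ^ r) * exp (p * y * real (r * r) - m * ln y)"
    (is "measure_pmf.prob _ ?\<A> \<le> _ * ?b")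
proof -
  define X where "X U = vertex_pairs (U :: nat set)" for U
  have "measure_pmf.prob (gnp n p) ?\<A> \<le> real (card {U. U \<subseteq> {..<n} \<and> card U = r}) * ?b"
  proof (rule prob_union_bound[OF finite_subsets_card])
    show "?\<A> \<subseteq> (\<Union>U\<in>{U. U \<subseteq> {..<n} \<and> card U = r}. {E. real (card (E \<inter> X U)) \<ge> m})"
    proof
      fix E assume "E \<in> ?\<A>"
      then obtain U where E: "E \<subseteq> vertex_pairs {..<n}" "U \<subseteq> {..<n}" "card U = r"
        "m \<le> real (card {e \<in> E. e \<subseteq> U})" by (auto simp: not_less)
      moreover have "{e \<in> E. e \<subseteq> U} = E \<inter> X U" using E(1) by (auto simp: X_def vertex_pairs_def)
      ultimately show "E \<in> (\<Union>U\<in>{U. U \<subseteq> {..<n} \<and> card U = r}. {E. real (card (E \<inter> X U)) \<ge> m})" by auto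
    qed
    fix U assume "U \<in> {U. U \<subseteq> {..<n} \<and> card U = r}"
    then have U: "U \<subseteq> {..<n}" "card U = r" by auto
    have fU: "finite U" using U finite_subset by blast
    have "card (X U) = r choose 2" using n_subsets[OF fU, of 2] U by (simp add: X_def vertex_pairs_def)
    also have "\<dots> \<le> r * r" by (simp add: choose_two div_le_dividend le_trans[OF div_le_dividend])
    finally have "real (card (X U)) \<le> real (r * r)" by (rule of_nat_mono)
    then have "p * y * real (card (X U)) \<le> p * y * real (r * r)"
      using p y by (intro mult_left_mono) auto
    moreover have "X U \<subseteq> vertex_pairs {..<n}" using U by (auto simp: X_def vertex_pairs_def)
    ultimately show "measure_pmf.prob (gnp n p) {E. real (card (E \<inter> X U)) \<ge> m} \<le> ?b"
      using prob_gnp_many_edges[OF p _ y, of "X U" n m] by (auto intro: order_trans)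
  qed
  also have "\<dots> \<le> real (n ^ r) * ?b"
    by (intro mult_right_mono of_nat_mono card_subsets_le) auto
  finally show ?thesis .
qed

section \<open>Proper connection number of random graphs\<close>

text \<open>\<open>proper_connection_number\<close> is unspecified on disconnected graphs; this
  property is increasing in \<open>E\<close>. Restricting the colours on all sets, not only on
  edges, lets one colouring serve every larger edge set.\<close>

definition two_colourable :: "nat \<Rightarrow> nat set set \<Rightarrow> bool" where
  "two_colourable n E \<longleftrightarrow> (\<exists>c. range c \<subseteq> {0, 1} \<and> proper_connected {..<n} E c)"

lemma two_colourable_mono:
  assumes "two_colourable n E" "E \<subseteq> E'" shows "two_colourable n E'"
proof -
  have "is_path V E u vs v \<Longrightarrow> is_path V E' u vs v" for V u v vs
    using assms(2) by (auto simp: is_path_def)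
  then have "proper_connected V E c \<Longrightarrow> proper_connected V E' c" for V c
    unfolding proper_connected_def by metis
  then show ?thesis
    using assms(1) unfolding two_colourable_def by metis
qed

lemma two_colourable_imp:
  assumes "two_colourable n E" "n > 0"
  shows "connected_graph {..<n} E \<and> proper_connection_number {..<n} E \<le> 2"
proof
  obtain c where c: "range c \<subseteq> {0, 1 :: nat}" "proper_connected {..<n} E c"
    using assms(1) by (auto simp: two_colourable_def)
  have "\<exists>vs. is_path {..<n} E u vs v" if "u < n" "v < n" for u v
  proof (cases "u = v")
    case True
    then show ?thesis using that by (intro exI[of _ "[u]"]) (auto simp: is_path_def)
  next
    case False
    then show ?thesis using c(2) that by (auto simp: proper_connected_def)
  qed
  then show "connected_graph {..<n} E"
    using assms(2) by (auto simp: connected_graph_def)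
  have "proper_connection_number {..<n} E \<le> card (c ` E)"
    unfolding proper_connection_number_def by (rule Least_le, rule exI[of _ c]) (simp add: c(2))
  moreover have "c ` E \<subseteq> {0, 1}" using c(1) by (meson image_subset_iff range_subsetD)
  then have "card (c ` E) \<le> card {0, 1 :: nat}" by (rule card_mono[rotated]) simp
  ultimately show "proper_connection_number {..<n} E \<le> 2" by simp
qed

text \<open>
  The constants \<open>1/1000\<close> and \<open>exp 16000\<close> are chosen such that a vertex has degree below
  \<open>D\<close> with probability at most \<open>n powr (-0.88)\<close>, is bad with probability at most
  \<open>n powr (-0.21)\<close> per class, and \<open>D / 4 * ln y = 4 * ln n\<close> beats the \<open>n ^ r\<close> choices of a set of size \<open>r\<close>.
\<close>

lemma prob_not_two_colourable:
  fixes n :: nat and p \<alpha> :: real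
  defines "L \<equiv> ln (real n)" and "y \<equiv> exp 16000"
  assumes n: "16 * y \<le> real n" and p: "p \<in> {0..1}" and \<alpha>: "\<alpha> \<ge> 0"
    and p_ge: "(L + \<alpha>) / real n \<le> p" and p_le: "p \<le> 2 * L / real n"
  shows "measure_pmf.prob (gnp n p) {E. \<not> two_colourable n E} \<le>
    exp (1 - \<alpha> / 2) + 16 * (2 * L) ^ 4 * exp (- 9/100 * L) + 4 ^ 6 * (2 * L) ^ 6 * exp (- 26/100 * L)
    + exp (real n * ln 4 - L * real n / (256 * y\<^sup>2)) + exp (- L)"
proof -
  define D where "D = L / 1000"
  \<comment> \<open>A set of r < 4 * a vertices then has r \<le> n / (2 y), which gives p * y * r
    \<le> L.\<close>
  define a where "a = nat \<lfloor>real n / (8 * y)\<rfloor>"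
  let ?P = "measure_pmf.prob (gnp n p)"
  have y: "y \<ge> 16001" "y > 0" "ln y = 16000"
    using exp_ge_add_one_self[of 16000] by (auto simp: y_def)
  \<comment> \<open>The value 1200 is what the bad vertices need: 9/1000 - 9/40 * (1 - 32/1200) =
    -21/100.\<close>
  have n1: "real n \<ge> 1200" "real n > 0" using n y by auto
  have "ln y \<le> L" unfolding L_def using n y by (subst ln_le_cancel_iff) auto
  then have L: "L \<ge> 16000" using y by simp
  have eL: "exp L = real n" using n1 by (simp add: L_def)
  have L_n: "L \<le> real n" unfolding L_def using n1 ln_le_minus_one[of "real n"] by linarith
  have D: "D \<ge> 12" "D > 0" using L by (auto simp: D_def)
  have p_ge': "L / real n \<le> p"
  proof -
    have "L / real n \<le> (L + \<alpha>) / real n" using \<alpha> n1 by (intro divide_right_mono) auto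
    then show ?thesis using p_ge by simp
  qed
  have "ln (10 :: real) \<le> 9" using ln_le_minus_one[of "10 :: real"] by simp
  then have D10: "D * ln 10 \<le> 9/1000 * L" using D mult_left_mono[of "ln 10" 9 D] by (simp add: D_def)
  have p_lower: "L - L * b / real n \<le> p * (real n - b)" if "b \<le> real n" for b
  proof -
    have "L / real n * (real n - b) \<le> p * (real n - b)" using that p_ge' by (intro mult_right_mono) auto
    then show ?thesis using n1 by (simp add: field_simps)
  qed
  have q1: "exp (D * ln 10 - 9/10 * p * (real n - real l)) \<le> exp (- 88/100 * L)" if "l \<le> 5" for l :: nat
  proof -
    have "p * (real n - 5) \<le> p * (real n - real l)" using that p by (intro mult_left_mono) auto
    moreover have "L * 5 / real n \<le> L / 240" using n1 L by (simp add: field_simps)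
    ultimately have "L - L / 240 \<le> p * (real n - real l)" using p_lower[of 5] n1 by linarith
    then show ?thesis using D10 L by simp
  qed
  have q4: "exp (D * ln 10 - 9/10 * p * (real n / 4 - 8)) \<le> exp (- 21/100 * L)"
  proof -
    have "L * 32 / real n \<le> L * 32 / 1200" using n1 L by (intro divide_left_mono) auto
    then have "L - L * 32 / 1200 \<le> p * (real n - 32)" using p_lower[of 32] n1 by linarith
    moreover have "9/10 * p * (real n / 4 - 8) = 9/40 * (p * (real n - 32))" by (simp add: field_simps)
    ultimately show ?thesis using D10 L unfolding exp_le_cancel_iff by linarith
  qed
  have np: "real n * p \<le> 2 * L" using p_le n1 by (simp add: field_simps)
  define A1 where "A1 = {E. \<exists>v<n. nbrs E v = {}}"
  define A2 where "A2 l = {E. E \<subseteq> vertex_pairs {..<n} \<and> (\<exists>vs. distinct vs \<and> length vs = l \<and>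
      set vs \<subseteq> {..<n} \<and> set (path_edges vs) \<subseteq> E \<and> hd vs \<in> low n E D \<and> last vs \<in> bad n E D)}" for l
  define A3 where "A3 = {E. E \<subseteq> vertex_pairs {..<n} \<and> (\<exists>v<n. \<not> card (nbrs E v \<inter> bad n E D) \<le> 5)}"
  define A4 where "A4 = {E. \<exists>A B. A \<subseteq> {..<n} \<and> B \<subseteq> {..<n} \<and> A \<inter> B = {} \<and>
      card A = a \<and> card B = a \<and> \<not> (\<exists>x\<in>A. \<exists>y\<in>B. {x, y} \<in> E)}"
  define A5 where "A5 r = {E. E \<subseteq> vertex_pairs {..<n} \<and> (\<exists>U. U \<subseteq> {..<n} \<and> U \<noteq> {} \<and> card U = r \<and>
      \<not> real (card {e \<in> E. e \<subseteq> U}) < D / 4 * real r)}" for r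
  have "?P A1 \<le> real n * exp (- p * (real n - 1))" unfolding A1_def by (rule prob_isolated[OF p])
  also have "\<dots> = exp (L - p * (real n - 1))" by (simp add: exp_diff exp_minus eL divide_inverse)
  also have "\<dots> \<le> exp (1 - \<alpha> / 2)"
  proof -
    have "(L + \<alpha>) / real n * (real n - 1) \<le> p * (real n - 1)"
      using p_ge n1 by (intro mult_right_mono) auto
    \<comment> \<open>Having n - 1 rather than n possible neighbours costs at most 1 + \<alpha> / 2
      in the exponent.\<close>
    moreover have "(L + \<alpha>) / real n * (real n - 1) = L + \<alpha> - L / real n - \<alpha> / real n"
      using n1 by (simp add: field_simps)
    moreover have "L / real n \<le> 1" using L_n n1 by simp
    moreover have "\<alpha> / real n \<le> \<alpha> / 2" using n1 \<alpha> by (intro divide_left_mono) auto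
    ultimately show ?thesis by simp
  qed
  finally have P1: "?P A1 \<le> exp (1 - \<alpha> / 2)" .
  have P2: "?P (A2 l) \<le> 4 * (2 * L) ^ 4 * exp (- 9/100 * L)" if l: "l \<in> {2..5}" for l
  proof -
    have "?P (A2 l) \<le> real (n ^ l * 4) * (p ^ (l - 1) * (exp (D * ln 10 - 9/10 * p * (real n - real l)) *
        exp (D * ln 10 - 9/10 * p * (real n / 4 - 1 - real l))))"
      unfolding A2_def using l by (intro prob_low_near_bad p) auto
    also have "\<dots> \<le> real (n ^ l * 4) * (p ^ (l - 1) * (exp (- 88/100 * L) * exp (- 21/100 * L)))"
    proof -
      have "p * (real n / 4 - 8) \<le> p * (real n / 4 - 1 - real l)"
        using l p by (intro mult_left_mono) auto
      then have "exp (D * ln 10 - 9/10 * p * (real n / 4 - 1 - real l)) \<le> exp (- 21/100 * L)"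
        using q4 by (intro order_trans[OF _ q4]) simp
      then show ?thesis using q1[of l] l p by (intro mult_left_mono mult_mono) auto
    qed
    \<comment> \<open>One vertex of the path costs n, each other one only n p, against the gain
      \<open>n powr (-1.09)\<close>.\<close>
    also have "\<dots> = 4 * real n * (real n * p) ^ (l - 1) * exp (- 109/100 * L)"
    proof -
      have "real n ^ l = real n * real n ^ (l - 1)" using l by (cases l) auto
      then show ?thesis by (simp add: power_mult_distrib exp_add[symmetric])
    qed
    also have "\<dots> \<le> 4 * real n * (2 * L) ^ 4 * exp (- 109/100 * L)"
    proof -
      have "(real n * p) ^ (l - 1) \<le> (2 * L) ^ (l - 1)" using np p by (intro power_mono) auto
      also have "\<dots> \<le> (2 * L) ^ 4" using L l by (intro power_increasing) auto
      finally show ?thesis by (intro mult_right_mono mult_left_mono) auto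
    qed
    also have "\<dots> = 4 * (2 * L) ^ 4 * exp (- 9/100 * L)"
      unfolding eL[symmetric] by (simp add: exp_add[symmetric])
    finally show ?thesis .
  qed
  have "?P A3 \<le> real n * (real (n ^ 6) * (4 ^ 6 * (p ^ 6 * exp (D * ln 10 - 9/10 * p * (real n / 4 - 8)) ^ 6)))"
    unfolding A3_def by (rule prob_many_bad_nbrs[OF p])
  also have "\<dots> \<le> real n * (real (n ^ 6) * (4 ^ 6 * (p ^ 6 * exp (- 21/100 * L) ^ 6)))"
    using p q4 by (intro mult_left_mono power_mono) auto
  \<comment> \<open>Each bad neighbour costs n p and gains \<open>n powr (-0.21)\<close>; six of
    them give 1.26, more than the 1 spent on \<open>v\<close>.\<close>
  also have "\<dots> = 4 ^ 6 * (real n * p) ^ 6 * (exp L * exp (6 * (- 21/100 * L)))"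
    by (simp add: eL power_mult_distrib exp_of_nat_mult[symmetric])
  also have "\<dots> \<le> 4 ^ 6 * (2 * L) ^ 6 * (exp L * exp (6 * (- 21/100 * L)))"
    using np p by (intro mult_right_mono mult_left_mono power_mono) auto
  also have "exp L * exp (6 * (- 21/100 * L)) = exp (- 26/100 * L)" by (simp add: exp_add[symmetric])
  finally have P3: "?P A3 \<le> 4 ^ 6 * (2 * L) ^ 6 * exp (- 26/100 * L)" .
  have a: "real a \<le> real n / (8 * y)" "real n / (16 * y) \<le> real a"
  proof -
    have "real a = real_of_int \<lfloor>real n / (8 * y)\<rfloor>" using y by (simp add: a_def)
    moreover have "real n / (8 * y) - 1 \<ge> real n / (16 * y)" using n y by (simp add: field_simps)
    ultimately show "real a \<le> real n / (8 * y)" "real n / (16 * y) \<le> real a"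
      using floor_correct[of "real n / (8 * y)"] by linarith+
  qed
  have "?P A4 \<le> 4 ^ n * exp (- p * real (a * a))" unfolding A4_def by (rule prob_not_dense[OF p])
  also have "\<dots> \<le> exp (real n * ln 4 - L * real n / (256 * y\<^sup>2))"
  proof -
    have "L * real n / (256 * y\<^sup>2) = L / real n * (real n / (16 * y)) ^ 2"
      using n1 y by (simp add: field_simps power2_eq_square)
    also have "\<dots> \<le> p * real a ^ 2"
      using p_ge' a(2) p y by (intro mult_mono power_mono) auto
    finally have "exp (- p * real (a * a)) \<le> exp (- (L * real n / (256 * y\<^sup>2)))"
      by (simp add: power2_eq_square)
    then have "4 ^ n * exp (- p * real (a * a)) \<le> 4 ^ n * exp (- (L * real n / (256 * y\<^sup>2)))"
      by (rule mult_left_mono) simp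
    also have "\<dots> = exp (real n * ln 4 - L * real n / (256 * y\<^sup>2))"
    proof -
      have "exp (real n * ln 4) = (4 :: real) ^ n" by (subst exp_of_nat_mult) simp
      then show ?thesis by (simp only: diff_conv_add_uminus exp_add)
    qed
    finally show ?thesis .
  qed
  finally have P4: "?P A4 \<le> exp (real n * ln 4 - L * real n / (256 * y\<^sup>2))" .
  have P5: "?P (A5 r) \<le> exp (- 2 * L)" if r: "r \<in> {1..<4 * a}" for r
  proof -
    have "?P (A5 r) \<le> real (n ^ r) * exp (p * y * real (r * r) - D / 4 * real r * ln y)"
      unfolding A5_def using y by (intro prob_dense_subset[OF p]) auto
    also have "\<dots> = exp (real r * L + (p * y * real (r * r) - D / 4 * real r * ln y))"
      using eL exp_of_nat_mult[of r L] by (simp add: exp_add)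
    \<comment> \<open>Per vertex the exponent is L for the choice, at most L from p * y * r, and -4
      L from the edges.\<close>
    also have "\<dots> \<le> exp (- 2 * L)"
    proof -
      have "real r \<le> 4 * real a" using r by simp
      also have "\<dots> \<le> real n / (2 * y)" using a(1) y by (simp add: field_simps)
      finally have "y * real r \<le> real n / 2" using y by (simp add: field_simps)
      then have "p * (y * real r) \<le> p * (real n / 2)" using p by (intro mult_left_mono) auto
      then have "p * y * real r \<le> L" using np by (simp add: algebra_simps)
      then have "p * y * real r * real r \<le> L * real r" by (intro mult_right_mono) auto
      moreover have "L * 1 \<le> L * real r" using r L by (intro mult_left_mono) auto
      ultimately show ?thesis using y(3) by (simp add: D_def algebra_simps)
    qed
    finally show ?thesis .
  qed
  \<comment> \<open>The deterministic criterion requires edges to be pairs of vertices below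
    \<open>n\<close>, which holds almost surely.\<close>
  have sub: "AE E in gnp n p. E \<in> {E. \<not> two_colourable n E} \<longrightarrow>
      E \<in> A1 \<union> (\<Union>l\<in>{2..5}. A2 l) \<union> A3 \<union> A4 \<union> (\<Union>r\<in>{1..<4 * a}. A5 r)"
  proof (unfold AE_measure_pmf_iff, intro ballI impI, rule ccontr)
    fix E assume "E \<in> set_pmf (gnp n p)" and not: "E \<in> {E. \<not> two_colourable n E}"
      and nin: "E \<notin> A1 \<union> (\<Union>l\<in>{2..5}. A2 l) \<union> A3 \<union> A4 \<union> (\<Union>r\<in>{1..<4 * a}. A5 r)"
    then have E: "E \<subseteq> vertex_pairs {..<n}" using set_pmf_gnp by blast
    have "scattered_graph n E D a"
    proof
      show "E \<subseteq> vertex_pairs {..<n}" "12 \<le> D" by fact+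
      show "nbrs E v \<noteq> {}" if "v < n" for v using that nin by (auto simp: A1_def)
      show "card (nbrs E v \<inter> bad n E D) \<le> 5" if "v < n" for v
        using that nin E unfolding A3_def by blast
      show "\<exists>x\<in>A. \<exists>y\<in>B. {x, y} \<in> E"
        if "A \<subseteq> {..<n}" "B \<subseteq> {..<n}" "A \<inter> B = {}" "card A = a" "card B = a" for A B
        using that nin unfolding A4_def by blast
      show False if "distinct vs" "2 \<le> length vs" "length vs \<le> 5" "set vs \<subseteq> {..<n}"
        "set (path_edges vs) \<subseteq> E" "hd vs \<in> low n E D" "last vs \<in> bad n E D" for vs
      proof -
        have "E \<in> A2 (length vs)" using that E unfolding A2_def by blast
        then show False using that(2,3) nin by auto
      qed
      show "real (card {e \<in> E. e \<subseteq> U}) < D / 4 * real (card U)"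
        if U: "U \<subseteq> {..<n}" "U \<noteq> {}" "card U < 4 * a" for U
      proof (rule ccontr)
        assume "\<not> ?thesis"
        then have "E \<in> A5 (card U)" using U E unfolding A5_def by blast
        moreover have "finite U" using U(1) finite_subset by blast
        then have "card U \<in> {1..<4 * a}" using U by (simp add: card_gt_0_iff Suc_leI)
        ultimately show False using nin by blast
      qed
    qed
    then have "two_colourable n E"
      unfolding two_colourable_def by (rule scattered_graph.two_colouring)
    then show False using not by simp
  qed
  have "?P {E. \<not> two_colourable n E} \<le> ?P (A1 \<union> (\<Union>l\<in>{2..5}. A2 l) \<union> A3 \<union> A4 \<union> (\<Union>r\<in>{1..<4 * a}. A5 r))"
    by (rule measure_pmf.finite_measure_mono_AE[OF sub]) simp
  moreover have Un: "?P (A \<union> B) \<le> ?P A + ?P B" for A B by (rule measure_Un_le) auto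
  ultimately have "?P {E. \<not> two_colourable n E} \<le>
      ?P A1 + ?P (\<Union>l\<in>{2..5}. A2 l) + ?P A3 + ?P A4 + ?P (\<Union>r\<in>{1..<4 * a}. A5 r)"
    using Un[of A1 "\<Union>l\<in>{2..5}. A2 l"] Un[of "A1 \<union> (\<Union>l\<in>{2..5}. A2 l)" A3]
      Un[of "A1 \<union> (\<Union>l\<in>{2..5}. A2 l) \<union> A3" A4]
      Un[of "A1 \<union> (\<Union>l\<in>{2..5}. A2 l) \<union> A3 \<union> A4" "\<Union>r\<in>{1..<4 * a}. A5 r"]
    by linarith
  moreover have "?P (\<Union>l\<in>{2..5}. A2 l) \<le> real (card {2..5::nat}) * (4 * (2 * L) ^ 4 * exp (- 9/100 * L))"
    by (intro prob_union_bound[OF _ subset_refl] P2) auto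
  then have "?P (\<Union>l\<in>{2..5}. A2 l) \<le> 16 * (2 * L) ^ 4 * exp (- 9/100 * L)" by simp
  moreover have "?P (\<Union>r\<in>{1..<4 * a}. A5 r) \<le> exp (- L)"
  proof -
    have "?P (\<Union>r\<in>{1..<4 * a}. A5 r) \<le> real (card {1..<4 * a}) * exp (- 2 * L)"
      by (intro prob_union_bound[OF _ subset_refl] P5) auto
    also have "\<dots> \<le> real n * exp (- 2 * L)"
    proof (rule mult_right_mono)
      have "4 * real a \<le> real n / (2 * y)" using a(1) y by (simp add: field_simps)
      also have "\<dots> \<le> real n / 1" using y n1 by (intro divide_left_mono) auto
      finally show "real (card {1..<4 * a}) \<le> real n" by simp
    qed simp
    also have "\<dots> = exp (- L)" unfolding eL[symmetric] by (simp add: exp_add[symmetric])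
    finally show ?thesis .
  qed
  ultimately show ?thesis using P1 P3 P4 by linarith
qed

theorem theorem1p9:
  fixes \<alpha> :: "nat \<Rightarrow> real" and p :: "nat \<Rightarrow> real"
  assumes "filterlim \<alpha> at_top sequentially"
    and "\<And>n. p n \<in> {0..1}"
    and "\<forall>\<^sub>F n in sequentially. p n \<ge> (ln (real n) + \<alpha> n) / real n"
  shows "(\<lambda>n. measure_pmf.prob (gnp n (p n))
            {E. connected_graph {..<n} E \<and> proper_connection_number {..<n} E \<le> 2})
         \<longlonglongrightarrow> 1"
proof -
  define y :: real where "y = exp 16000"
  define c where "c = 1 / (256 * y\<^sup>2)"
  have c: "c > 0" by (simp add: c_def y_def)
  \<comment> \<open>Capping \<alpha> at \<open>ln n\<close> keeps (ln n + \<beta>) / n below 2 ln n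
    / n. The capped probability \<open>q\<close> thus still satisfies the lower bound, and \<beta>
    still tends to infinity.\<close>
  define \<beta> where "\<beta> n = min (\<alpha> n) (ln (real n))" for n
  define q where "q n = min (p n) (2 * ln (real n) / real n)" for n
  define err where "err n = exp (1 - \<beta> n / 2) + 16 * (2 * ln (real n)) ^ 4 * exp (- 9/100 * ln (real n))
    + 4 ^ 6 * (2 * ln (real n)) ^ 6 * exp (- 26/100 * ln (real n))
    + exp (real n * ln 4 - ln (real n) * real n * c) + exp (- ln (real n))" for n
  have ln_top: "filterlim (\<lambda>n. ln (real n)) at_top sequentially" by real_asymp
  have \<beta>: "filterlim \<beta> at_top sequentially"
    unfolding \<beta>_def filterlim_at_top
  proof
    fix Z
    show "\<forall>\<^sub>F n in sequentially. Z \<le> min (\<alpha> n) (ln (real n))"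
      using eventually_conj[of "\<lambda>n. Z \<le> \<alpha> n" sequentially "\<lambda>n. Z \<le> ln (real n)"] assms(1) ln_top
      by (simp add: filterlim_at_top)
  qed
  have "(\<lambda>n. exp (1 - \<beta> n / 2)) \<longlonglongrightarrow> 0"
    by (rule filterlim_compose[OF _ \<beta>]) real_asymp
  moreover have "(\<lambda>n. 16 * (2 * ln (real n)) ^ 4 * exp (- 9/100 * ln (real n))) \<longlonglongrightarrow> 0" by real_asymp
  moreover have "(\<lambda>n. 4 ^ 6 * (2 * ln (real n)) ^ 6 * exp (- 26/100 * ln (real n))) \<longlonglongrightarrow> 0" by real_asymp
  \<comment> \<open>The constant \<open>c\<close> is minute but fixed and positive, so n ln n
    eventually dominates n.\<close>
  moreover have "(\<lambda>n. exp (real n * ln 4 - ln (real n) * real n * c)) \<longlonglongrightarrow> 0" using c by real_asymp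
  moreover have "(\<lambda>n. exp (- ln (real n))) \<longlonglongrightarrow> 0" by real_asymp
  ultimately have "err \<longlonglongrightarrow> 0 + 0 + 0 + 0 + 0" unfolding err_def by (intro tendsto_add)
  then have lower: "(\<lambda>n. 1 - err n) \<longlonglongrightarrow> 1" using tendsto_diff[of "\<lambda>_. 1" 1 _ err 0] by simp
  have "\<forall>\<^sub>F n in sequentially. 16 * y \<le> real n" by real_asymp
  moreover have "\<forall>\<^sub>F n in sequentially. 0 \<le> \<beta> n" using \<beta> by (simp add: filterlim_at_top)
  ultimately have "\<forall>\<^sub>F n in sequentially. 1 - err n \<le> measure_pmf.prob (gnp n (p n))
      {E. connected_graph {..<n} E \<and> proper_connection_number {..<n} E \<le> 2}"
    using assms(3)
  proof eventually_elim
    case (elim n)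
    have n: "n > 0" "real n \<ge> 1" using elim(1) exp_ge_add_one_self[of 16000] by (auto simp: y_def)
    have ln_n: "ln (real n) \<ge> 0" using n by simp
    have q: "q n \<in> {0..1}" "q n \<le> 2 * ln (real n) / real n" "q n \<le> p n"
      using assms(2)[of n] ln_n by (auto simp: q_def)
    have "(ln (real n) + \<beta> n) / real n \<le> (ln (real n) + \<alpha> n) / real n"
      by (intro divide_right_mono) (auto simp: \<beta>_def)
    moreover have "(ln (real n) + \<beta> n) / real n \<le> 2 * ln (real n) / real n"
      by (intro divide_right_mono) (auto simp: \<beta>_def)
    ultimately have "(ln (real n) + \<beta> n) / real n \<le> q n" using elim(3) by (simp add: q_def)
    then have "measure_pmf.prob (gnp n (q n)) {E. \<not> two_colourable n E} \<le> err n"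
      using prob_not_two_colourable[of n "q n" "\<beta> n"] elim(1,2) q(1,2) by (simp add: err_def y_def c_def)
    then have "1 - err n \<le> measure_pmf.prob (gnp n (q n)) {E. two_colourable n E}"
      using measure_pmf.prob_compl[of "{E. two_colourable n E}" "gnp n (q n)"]
      by (simp add: Compl_eq_Diff_UNIV[symmetric] Collect_neg_eq)
    also have "\<dots> \<le> measure_pmf.prob (gnp n (p n)) {E. two_colourable n E}"
      using q assms(2)[of n] two_colourable_mono by (intro prob_gnp_mono) auto
    also have "\<dots> \<le> measure_pmf.prob (gnp n (p n))
        {E. connected_graph {..<n} E \<and> proper_connection_number {..<n} E \<le> 2}"
      using two_colourable_imp n by (intro measure_pmf.finite_measure_mono) auto
    finally show ?case .
  qed
  then show ?thesis
    by (rule tendsto_sandwich[OF _ _ lower tendsto_const]) simp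
qed

end
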